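(* Let $r\in\{1,\infty\}$ and $N>2$ be an integer. Then $N$ is the least natural number $k$ with the following property: for every finite nonempty subset $A$ of $\mathbb{G}_r(N)$ and every $f \in E_r(A)$, $f$ is trivial in $\mathbb{G}_r(N)$ if and only if $f|_B$ is trivial in $\mathbb{G}_r(N)$ for every nonempty $B \subseteq A$ with $\mathrm{card}(B) \leqslant k$. In particular, for two distinct pairs $(r,N),(s,M) \in \{1,\infty\}\times\{0,2,3,4,\ldots\}$, the metric spaces $\mathbb{G}_r(N)$ and $\mathbb{G}_s(M)$ are isometric if and only if $r=s$ and $\{N,M\}=\{0,2\}$. Hence $\mathbb{G}_r(N)$ is not Urysohn for $N>2$.
   Context: All groups are Abelian. A value on $G$ is $p\colon G\to[0,\infty)$ with $p(x)=0\iff x=0$, $p(-x)=p(x)$, $p(x+y)\leqslant p(x)+p(y)$; it induces the metric $d(x,y)=p(x-y)$. Class $\mathcal{O}_0$: $\lim_n p(na)/n=0$ for all $a$. $\mathfrak{G}_r(N)$: separable valued Abelian groups of class $\mathcal{O}_0$ with $p\leqslant r$ (vacuous if $r=\infty$) and of exponent $N$ if $N\neq0$. $\mathbb{G}_r(N)$ is the valued Abelian group, unique up to isometric group isomorphism, which (G1) is complete and in $\mathfrak{G}_r(N)$; (G2) for every finite valued Abelian group $(H,+,q)$ (of exponent $N$ if $N\neq0$) with $q\leqslant r$, subgroup $K$, isometric homomorphism $\varphi\colon K\to\mathbb{G}_r(N)$ and $\varepsilon\in(0,1)$, there is a homomorphism $\varphi_\varepsilon\colon H\to\mathbb{G}_r(N)$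 with $p(\varphi(x)-\varphi_\varepsilon(x))\leqslant\varepsilon$ on $K$ and $(1-\varepsilon)q\leqslant p\circ\varphi_\varepsilon\leqslant(1+\varepsilon)q$ on $H$; (G3) if $N=0$, finite-order elements are dense. For a subset $A$ of a metric space $(X,d)$, a Katětov map on $A$ is $f\colon A\to[0,\infty)$ with $|f(x)-f(y)|\leqslant d(x,y)\leqslant f(x)+f(y)$ for $x,y\in A$; $E_r(A)$ is the set of Katětov maps on $A$ with values $\leqslant r$. A Katětov map $f$ on $A\subseteq X$ is trivial in $X$ if there is $b\in X$ with $f(a)=d(a,b)$ for all $a\in A$. A metric space $X$ is Urysohn if it is separable and complete, every separable metric space of diameter at most $\mathrm{diam}\,X$ embeds isometrically into $X$, and every isometry between finite subsets of $X$ extends to an isometry of $X$ onto itself. *)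

theory Defs
  imports "HOL-Analysis.Analysis" "HOL-Algebra.Algebra"
begin

definition gmul :: "nat \<Rightarrow> 'a::ab_group_add \<Rightarrow> 'a" where
  "gmul n a = (\<Sum>i<n. a)"

definition is_value :: "('a::ab_group_add \<Rightarrow> real) \<Rightarrow> bool" where
  "is_value p \<longleftrightarrow> (\<forall>x. p x \<ge> 0) \<and> (\<forall>x. p x = 0 \<longleftrightarrow> x = 0) \<and>
     (\<forall>x. p (- x) = p x) \<and> (\<forall>x y. p (x + y) \<le> p x + p y)"

definition class_O0 :: "('a::ab_group_add \<Rightarrow> real) \<Rightarrow> bool" where
  "class_O0 p \<longleftrightarrow> (\<forall>a. (\<lambda>n. p (gmul n a) / real n) \<longlonglongrightarrow> 0)"

definition vg_separable :: "('a::ab_group_add \<Rightarrow> real) \<Rightarrow> bool" where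
  "vg_separable p \<longleftrightarrow> (\<exists>D. countable D \<and> (\<forall>x. \<forall>e>0. \<exists>y\<in>D. p (x - y) < e))"

definition vg_complete :: "('a::ab_group_add \<Rightarrow> real) \<Rightarrow> bool" where
  "vg_complete p \<longleftrightarrow> (\<forall>u::nat \<Rightarrow> 'a.
     (\<forall>e>0. \<exists>n0. \<forall>m\<ge>n0. \<forall>n\<ge>n0. p (u m - u n) < e) \<longrightarrow>
     (\<exists>l. \<forall>e>0. \<exists>n0. \<forall>n\<ge>n0. p (u n - l) < e))"

definition has_exponent :: "nat \<Rightarrow> 'a::ab_group_add itself \<Rightarrow> bool" where
  "has_exponent N _ \<longleftrightarrow> (\<forall>x::'a. gmul N x = 0)"

definition in_frakG :: "ereal \<Rightarrow> nat \<Rightarrow> ('a::ab_group_add \<Rightarrow> real) \<Rightarrow> bool" where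
  "in_frakG r N p \<longleftrightarrow> is_value p \<and> vg_separable p \<and> class_O0 p \<and>
     (\<forall>x. ereal (p x) \<le> r) \<and> (N \<noteq> 0 \<longrightarrow> has_exponent N TYPE('a))"

definition is_value_on :: "(nat, 'm) monoid_scheme \<Rightarrow> (nat \<Rightarrow> real) \<Rightarrow> bool" where
  "is_value_on H q \<longleftrightarrow>
     (\<forall>x\<in>carrier H. q x \<ge> 0) \<and> (\<forall>x\<in>carrier H. q x = 0 \<longleftrightarrow> x = \<one>\<^bsub>H\<^esub>) \<and>
     (\<forall>x\<in>carrier H. q (inv\<^bsub>H\<^esub> x) = q x) \<and>
     (\<forall>x\<in>carrier H. \<forall>y\<in>carrier H. q (x \<otimes>\<^bsub>H\<^esub> y) \<le> q x + q y)"

text \<open>Property (G2).  Every finite group is isomorphic to one with carrier contained in nat,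
  so quantifying over such groups covers all finite valued Abelian groups.\<close>
definition prop_G2 :: "ereal \<Rightarrow> nat \<Rightarrow> ('a::ab_group_add \<Rightarrow> real) \<Rightarrow> bool" where
  "prop_G2 r N p \<longleftrightarrow>
    (\<forall>(H::nat monoid) (q::nat \<Rightarrow> real) K (\<phi>::nat \<Rightarrow> 'a) (\<epsilon>::real).
       comm_group H \<and> finite (carrier H) \<and> is_value_on H q \<and>
       (N \<noteq> 0 \<longrightarrow> (\<forall>x\<in>carrier H. x [^]\<^bsub>H\<^esub> N = \<one>\<^bsub>H\<^esub>)) \<and>
       (\<forall>x\<in>carrier H. ereal (q x) \<le> r) \<and>
       subgroup K H \<and>
       (\<forall>x\<in>K. \<forall>y\<in>K. \<phi> (x \<otimes>\<^bsub>H\<^esub> y) = \<phi> x + \<phi> y) \<and>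
       (\<forall>x\<in>K. p (\<phi> x) = q x) \<and>
       0 < \<epsilon> \<and> \<epsilon> < 1
     \<longrightarrow> (\<exists>\<psi>::nat \<Rightarrow> 'a.
           (\<forall>x\<in>carrier H. \<forall>y\<in>carrier H. \<psi> (x \<otimes>\<^bsub>H\<^esub> y) = \<psi> x + \<psi> y) \<and>
           (\<forall>x\<in>K. p (\<phi> x - \<psi> x) \<le> \<epsilon>) \<and>
           (\<forall>x\<in>carrier H. (1 - \<epsilon>) * q x \<le> p (\<psi> x) \<and> p (\<psi> x) \<le> (1 + \<epsilon>) * q x)))"

definition is_GG :: "ereal \<Rightarrow> nat \<Rightarrow> ('a::ab_group_add \<Rightarrow> real) \<Rightarrow> bool" where
  "is_GG r N p \<longleftrightarrow>
     vg_complete p \<and> in_frakG r N p \<and>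
     prop_G2 r N p \<and>
     (N = 0 \<longrightarrow> (\<forall>x. \<forall>e>0. \<exists>y. (\<exists>n>0. gmul n y = 0) \<and> p (x - y) < e))"

definition katetov_on :: "('a::ab_group_add \<Rightarrow> real) \<Rightarrow> 'a set \<Rightarrow> ('a \<Rightarrow> real) \<Rightarrow> bool" where
  "katetov_on p A f \<longleftrightarrow> (\<forall>x\<in>A. f x \<ge> 0) \<and>
     (\<forall>x\<in>A. \<forall>y\<in>A. \<bar>f x - f y\<bar> \<le> p (x - y) \<and> p (x - y) \<le> f x + f y)"

definition E_r :: "ereal \<Rightarrow> ('a::ab_group_add \<Rightarrow> real) \<Rightarrow> 'a set \<Rightarrow> ('a \<Rightarrow> real) set" where
  "E_r r p A = {f. katetov_on p A f \<and> (\<forall>x\<in>A. ereal (f x) \<le> r)}"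

definition trivial_in :: "('a::ab_group_add \<Rightarrow> real) \<Rightarrow> 'a set \<Rightarrow> ('a \<Rightarrow> real) \<Rightarrow> bool" where
  "trivial_in p A f \<longleftrightarrow> (\<exists>b. \<forall>a\<in>A. f a = p (a - b))"

definition k_property :: "ereal \<Rightarrow> ('a::ab_group_add \<Rightarrow> real) \<Rightarrow> nat \<Rightarrow> bool" where
  "k_property r p k \<longleftrightarrow>
     (\<forall>A f. finite A \<and> A \<noteq> {} \<and> f \<in> E_r r p A \<longrightarrow>
        (trivial_in p A f \<longleftrightarrow>
           (\<forall>B. B \<subseteq> A \<and> B \<noteq> {} \<and> card B \<le> k \<longrightarrow> trivial_in p B f)))"

definition isometric_vg :: "('a::ab_group_add \<Rightarrow> real) \<Rightarrow> ('b::ab_group_add \<Rightarrow> real) \<Rightarrow> bool" where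
  "isometric_vg p q \<longleftrightarrow> (\<exists>g::'a \<Rightarrow> 'b. bij g \<and> (\<forall>x y. q (g x - g y) = p (x - y)))"

text \<open>Abstract metric space (S, d) with S a set of reals.  Every separable metric space has
  cardinality at most the continuum, hence is isometric to such a space.\<close>
definition metric_on :: "'c set \<Rightarrow> ('c \<Rightarrow> 'c \<Rightarrow> real) \<Rightarrow> bool" where
  "metric_on S d \<longleftrightarrow> (\<forall>x\<in>S. \<forall>y\<in>S. d x y \<ge> 0 \<and> (d x y = 0 \<longleftrightarrow> x = y) \<and> d x y = d y x) \<and>
     (\<forall>x\<in>S. \<forall>y\<in>S. \<forall>z\<in>S. d x z \<le> d x y + d y z)"

definition separable_on :: "'c set \<Rightarrow> ('c \<Rightarrow> 'c \<Rightarrow> real) \<Rightarrow> bool" where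
  "separable_on S d \<longleftrightarrow> (\<exists>D\<subseteq>S. countable D \<and> (\<forall>x\<in>S. \<forall>e>0. \<exists>y\<in>D. d x y < e))"

definition mdiam :: "'c set \<Rightarrow> ('c \<Rightarrow> 'c \<Rightarrow> real) \<Rightarrow> ereal" where
  "mdiam S d = (SUP x\<in>S. SUP y\<in>S. ereal (d x y))"

definition urysohn_vg :: "('a::ab_group_add \<Rightarrow> real) \<Rightarrow> bool" where
  "urysohn_vg p \<longleftrightarrow>
     vg_separable p \<and> vg_complete p \<and>
     (\<forall>(S::real set) d. metric_on S d \<and> separable_on S d \<and>
          mdiam S d \<le> mdiam (UNIV::'a set) (\<lambda>x y. p (x - y)) \<longrightarrow>
        (\<exists>e::real \<Rightarrow> 'a. \<forall>x\<in>S. \<forall>y\<in>S. p (e x - e y) = d x y)) \<and>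
     (\<forall>F (g::'a \<Rightarrow> 'a). finite F \<and> (\<forall>x\<in>F. \<forall>y\<in>F. p (g x - g y) = p (x - y)) \<longrightarrow>
        (\<exists>h. bij h \<and> (\<forall>x y. p (h x - h y) = p (x - y)) \<and> (\<forall>x\<in>F. h x = g x)))"

end

theory Submission
  imports Defs "HOL-Library.Function_Algebras"
begin

text \<open>For a finite subgroup \<open>K\<close> of the group \<open>G\<close>, a function \<open>f\<close> on \<open>A \<subseteq> K\<close> is a distance function
  \<open>a \<mapsto> p (a - b)\<close> as soon as the value of \<open>K\<close> extends to the direct sum of \<open>K\<close> with a cyclic group of
  order \<open>N\<close> generated by \<open>b\<close>, with value \<open>f a\<close> at \<open>a - b\<close>: then (G2) and completeness realise \<open>b\<close> in \<open>G\<close>.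
  The largest candidate for such a value is the infimum of the costs of words in elements of \<open>K\<close> and
  the \<open>\<plusminus>(a - b)\<close>.  Pairs of opposite letters cancel by the Katetov inequalities, so the only further
  obstructions come from words of \<open>N\<close> equal signs (where \<open>b\<close> disappears), and these involve at most
  \<open>N\<close> points.  For \<open>N = 2\<close> they reduce to the Katetov inequalities; for \<open>N = 0\<close> one approximates by elements of
  finite order and takes \<open>b\<close> of large order.  So for \<open>N \<in> {0, 2}\<close> all Katetov maps are trivial, and a
  back-and-forth construction gives the isometry.  For \<open>N > 2\<close> there are \<open>N\<close> points \<open>a\<^sub>i\<close> and a constant \<open>\<kappa>\<close> such
  that \<open>p (a\<^sub>1 + \<dots> + a\<^sub>N)\<close> exceeds \<open>N \<kappa>\<close> although no other sum of \<open>N\<close> of the points does; hence the constant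
  Katetov map \<open>\<kappa>\<close> is nontrivial on these points but trivial on every proper subset.\<close>

section \<open>Pseudo-values\<close>

lemma gmul_0 [simp]: "gmul 0 a = 0"
  by (simp add: gmul_def)

lemma gmul_Suc [simp]: "gmul (Suc n) a = gmul n a + a"
  by (simp add: gmul_def)

lemma gmul_add: "gmul (m + n) a = gmul m a + gmul n a"
  by (induction n) (auto simp: algebra_simps)

lemma gmul_of_zero [simp]: "gmul n 0 = 0"
  by (simp add: gmul_def)

locale valued =
  fixes p :: "'a::ab_group_add \<Rightarrow> real"
  assumes val: "is_value p"
begin

lemma nonneg [simp]: "0 \<le> p x"
  and eq_0_iff [simp]: "p x = 0 \<longleftrightarrow> x = 0"
  and minus [simp]: "p (- x) = p x"
  and add: "p (x + y) \<le> p x + p y"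
  using val by (auto simp: is_value_def)

lemma zero [simp]: "p 0 = 0"
  by simp

lemma diff_commute: "p (x - y) = p (y - x)"
  using minus[of "x - y"] by simp

lemma triangle: "p (x - z) \<le> p (x - y) + p (y - z)"
  using add[of "x - y" "y - z"] by simp

lemma diff_le: "p x \<le> p y + p (x - y)"
  using add[of y "x - y"] by simp

lemma abs_diff: "\<bar>p x - p y\<bar> \<le> p (x - y)"
  using diff_le[of x y] diff_le[of y x] diff_commute[of x y] by simp

end

definition add_subgroup :: "'c::ab_group_add set \<Rightarrow> bool" where
  "add_subgroup G \<longleftrightarrow> 0 \<in> G \<and> (\<forall>x\<in>G. \<forall>y\<in>G. x + y \<in> G) \<and> (\<forall>x\<in>G. - x \<in> G)"

lemma add_subgroupD:
  assumes "add_subgroup G"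
  shows "0 \<in> G" "\<And>x y. x \<in> G \<Longrightarrow> y \<in> G \<Longrightarrow> x + y \<in> G"
    "\<And>x. x \<in> G \<Longrightarrow> - x \<in> G" "\<And>x y. x \<in> G \<Longrightarrow> y \<in> G \<Longrightarrow> x - y \<in> G"
proof -
  show "x - y \<in> G" if "x \<in> G" "y \<in> G" for x y
    using assms that unfolding add_subgroup_def by (metis diff_conv_add_uminus)
qed (use assms in \<open>auto simp: add_subgroup_def\<close>)

text \<open>Nonzero elements may have value 0, so a relation such as \<open>M b = 0\<close> can be
  imposed by giving \<open>M b\<close> the value 0, without forming a quotient group.\<close>

definition pvalue_on :: "'c::ab_group_add set \<Rightarrow> ('c \<Rightarrow> real) \<Rightarrow> bool" where
  "pvalue_on G q \<longleftrightarrow> q 0 = 0 \<and> (\<forall>x\<in>G. 0 \<le> q x \<and> q (- x) = q x) \<and>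
     (\<forall>x\<in>G. \<forall>y\<in>G. q (x + y) \<le> q x + q y)"

lemma pvalue_onD:
  assumes "pvalue_on G q"
  shows "q 0 = 0" "\<And>x. x \<in> G \<Longrightarrow> 0 \<le> q x" "\<And>x. x \<in> G \<Longrightarrow> q (- x) = q x"
    "\<And>x y. x \<in> G \<Longrightarrow> y \<in> G \<Longrightarrow> q (x + y) \<le> q x + q y"
  using assms by (auto simp: pvalue_on_def)

lemma pvalue_on_mono: "pvalue_on G q \<Longrightarrow> G' \<subseteq> G \<Longrightarrow> pvalue_on G' q"
  unfolding pvalue_on_def by blast

lemma pvalue_on_diff:
  assumes "add_subgroup G" "pvalue_on G q" "x \<in> G" "y \<in> G"
  shows "q (x - y) = q (y - x)" "q x \<le> q y + q (x - y)" "\<And>z. z \<in> G \<Longrightarrow> q (x - z) \<le> q (x - y) + q (y - z)"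
proof -
  note S = add_subgroupD[OF assms(1)] and P = pvalue_onD[OF assms(2)]
  show "q (x - y) = q (y - x)"
    using P(3)[of "x - y"] S(4) assms by simp
  show "q x \<le> q y + q (x - y)"
    using P(4)[of y "x - y"] S(4) assms by simp
  show "q (x - z) \<le> q (x - y) + q (y - z)" if "z \<in> G" for z
    using P(4)[of "x - y" "y - z"] S(4) assms that by simp
qed

text \<open>Dividing \<open>\<Gamma>\<close> by the elements of value 0 turns \<open>q\<close> into
  a value, and the quotient is finite because \<open>T\<close> meets every class. Its classes are
  coded by natural numbers, as (G2) demands. This makes (G2) applicable to infinite groups such as
  the product of a finite group with the integers.\<close>

lemma (in valued) prop_G2_pseudo:
  fixes q :: "'c::ab_group_add \<Rightarrow> real"
  assumes G2: "prop_G2 r N p"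
    and \<Gamma>: "add_subgroup \<Gamma>" and q: "pvalue_on \<Gamma> q"
    and T: "finite T" "T \<subseteq> \<Gamma>" "\<And>x. x \<in> \<Gamma> \<Longrightarrow> \<exists>t\<in>T. q (x - t) = 0"
    and exponent: "\<And>x. N \<noteq> 0 \<Longrightarrow> x \<in> \<Gamma> \<Longrightarrow> q (gmul N x) = 0"
    and le: "\<And>x. x \<in> \<Gamma> \<Longrightarrow> ereal (q x) \<le> r"
    and \<Delta>: "add_subgroup \<Delta>" "\<Delta> \<subseteq> \<Gamma>"
    and \<phi>: "\<And>x y. x \<in> \<Delta> \<Longrightarrow> y \<in> \<Delta> \<Longrightarrow> \<phi> (x + y) = \<phi> x + \<phi> y" "\<And>x. x \<in> \<Delta> \<Longrightarrow> p (\<phi> x) = q x"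
    and \<epsilon>: "0 < \<epsilon>" "\<epsilon> < 1"
  shows "\<exists>\<psi>. (\<forall>x\<in>\<Gamma>. \<forall>y\<in>\<Gamma>. \<psi> (x + y) = \<psi> x + \<psi> y) \<and> (\<forall>x\<in>\<Delta>. p (\<phi> x - \<psi> x) \<le> \<epsilon>) \<and>
    (\<forall>x\<in>\<Gamma>. (1 - \<epsilon>) * q x \<le> p (\<psi> x) \<and> p (\<psi> x) \<le> (1 + \<epsilon>) * q x)"
proof -
  note S = add_subgroupD[OF \<Gamma>] and P = pvalue_onD[OF q] and D = pvalue_on_diff[OF \<Gamma> q]
  \<comment> \<open>On \<open>\<Gamma>\<close> the choice depends only on the class of
    \<open>x\<close>, because the predicate under the choice operator is the same for all members of
    a class.\<close>
  define c where "c x = (SOME t. t \<in> T \<and> q (x - t) = 0)" for x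
  have c: "c x \<in> T" "q (x - c x) = 0" if "x \<in> \<Gamma>" for x
    using T(3)[OF that] someI_ex[of "\<lambda>t. t \<in> T \<and> q (x - t) = 0"] unfolding c_def by blast+
  have c_eq: "c x = c y \<longleftrightarrow> q (x - y) = 0" if x: "x \<in> \<Gamma>" and y: "y \<in> \<Gamma>" for x y
  proof
    assume "c x = c y"
    then have "q (x - y) \<le> q (x - c x) + q (c y - y)"
      using D(3)[OF x _ y, of "c x"] c(1)[OF x] T(2) by auto
    also have "q (c y - y) = 0"
      using c[OF y] D(1)[OF y, of "c y"] T(2) by auto
    finally show "q (x - y) = 0"
      using c(2)[OF x] P(2)[of "x - y"] S(4) x y by force
  next
    assume xy: "q (x - y) = 0"
    have "q (x - t) = 0 \<longleftrightarrow> q (y - t) = 0" if "t \<in> T" for t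
    proof -
      have t: "t \<in> \<Gamma>" using that T(2) by auto
      show ?thesis
        using D(3)[OF x y t] D(3)[OF y x t] xy D(1)[OF x y] P(2) S(4) x y t by (smt (verit))
    qed
    then have "(\<lambda>t. t \<in> T \<and> q (x - t) = 0) = (\<lambda>t. t \<in> T \<and> q (y - t) = 0)"
      by auto
    then show "c x = c y"
      by (simp add: c_def)
  qed
  obtain \<iota> :: "'c \<Rightarrow> nat" where \<iota>: "inj_on \<iota> T"
    using finite_imp_inj_to_nat_seg[OF T(1)] by blast
  define \<rho> where "\<rho> x = \<iota> (c x)" for x
  have \<rho>_eq: "\<rho> x = \<rho> y \<longleftrightarrow> q (x - y) = 0" if "x \<in> \<Gamma>" "y \<in> \<Gamma>" for x y
    using c_eq[OF that] \<iota> c(1) that unfolding \<rho>_def by (metis inj_on_eq_iff)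
  have fin: "finite (\<rho> ` \<Gamma>)"
    by (rule finite_subset[of _ "\<iota> ` T"]) (use c T in \<open>auto simp: \<rho>_def\<close>)
  \<comment> \<open>\<open>\<sigma>\<close> picks an element of the class with code
    \<open>n\<close>; the group operation on codes is defined through it.\<close>
  define \<sigma> where "\<sigma> n = (SOME x. x \<in> \<Gamma> \<and> \<rho> x = n)" for n
  have \<sigma>: "\<sigma> (\<rho> x) \<in> \<Gamma>" "\<rho> (\<sigma> (\<rho> x)) = \<rho> x" if "x \<in> \<Gamma>" for x
    using someI_ex[of "\<lambda>y. y \<in> \<Gamma> \<and> \<rho> y = \<rho> x"] that unfolding \<sigma>_def by blast+
  have \<sigma>0: "q (\<sigma> (\<rho> x) - x) = 0" if "x \<in> \<Gamma>" for x
    using \<rho>_eq[of "\<sigma> (\<rho> x)" x] \<sigma>[OF that] that by simp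
  have q_cong: "q x = q y" if "q (x - y) = 0" "x \<in> \<Gamma>" "y \<in> \<Gamma>" for x y
    using D(2)[of x y] D(2)[of y x] D(1)[of x y] that by auto
  define H :: "nat monoid" where
    "H = \<lparr>carrier = \<rho> ` \<Gamma>, mult = \<lambda>m n. \<rho> (\<sigma> m + \<sigma> n), one = \<rho> 0\<rparr>"
  have car: "carrier H = \<rho> ` \<Gamma>" and one: "\<one>\<^bsub>H\<^esub> = \<rho> 0"
    by (simp_all add: H_def)
  have mult: "\<rho> x \<otimes>\<^bsub>H\<^esub> \<rho> y = \<rho> (x + y)" if x: "x \<in> \<Gamma>" and y: "y \<in> \<Gamma>" for x y
  proof -
    have "q (\<sigma> (\<rho> x) + \<sigma> (\<rho> y) - (x + y)) \<le> q (\<sigma> (\<rho> x) - x) + q (\<sigma> (\<rho> y) - y)"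
      using P(4)[of "\<sigma> (\<rho> x) - x" "\<sigma> (\<rho> y) - y"] S(4) \<sigma> x y by (simp add: algebra_simps)
    also have "\<dots> = 0"
      using \<sigma>0 x y by simp
    finally have "q (\<sigma> (\<rho> x) + \<sigma> (\<rho> y) - (x + y)) = 0"
      using P(2) S(2,4) \<sigma> x y by (smt (verit))
    then show ?thesis
      using \<rho>_eq S(2) \<sigma> x y by (simp add: H_def)
  qed
  interpret H: comm_group H
  proof (rule comm_groupI)
    show "\<exists>y\<in>carrier H. y \<otimes>\<^bsub>H\<^esub> x = \<one>\<^bsub>H\<^esub>" if "x \<in> carrier H" for x
    proof -
      from that obtain a where a: "a \<in> \<Gamma>" "x = \<rho> a" by (auto simp: car)
      then have "\<rho> (- a) \<otimes>\<^bsub>H\<^esub> x = \<one>\<^bsub>H\<^esub>"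
        using mult[of "- a" a] S(3) one by simp
      then show ?thesis using a S(3) car by auto
    qed
  qed (auto simp: car mult one S algebra_simps)
  have inv: "inv\<^bsub>H\<^esub> (\<rho> x) = \<rho> (- x)" if "x \<in> \<Gamma>" for x
    by (rule H.inv_equality) (use that mult[of "- x" x] S(3) in \<open>auto simp: car one\<close>)
  have pow: "\<rho> x [^]\<^bsub>H\<^esub> n = \<rho> (gmul n x) \<and> gmul n x \<in> \<Gamma>" if "x \<in> \<Gamma>" for x and n :: nat
    by (induction n) (use that S mult one in auto)
  define qn where "qn n = q (\<sigma> n)" for n
  have qn: "qn (\<rho> x) = q x" if "x \<in> \<Gamma>" for x
    using q_cong[OF \<sigma>0[OF that]] \<sigma> that by (simp add: qn_def)
  have v: "is_value_on H qn"
    unfolding is_value_on_def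
    by (auto simp: car one inv mult qn S P \<rho>_eq)
  have e: "x [^]\<^bsub>H\<^esub> N = \<one>\<^bsub>H\<^esub>" if "N \<noteq> 0" "x \<in> carrier H" for x
    using that pow exponent by (auto simp: car one \<rho>_eq S)
  \<comment> \<open>This is well defined on classes: \<open>\<phi>\<close> preserves values, hence
    identifies two elements of \<open>\<Delta>\<close> whose difference has value 0.\<close>
  define \<phi>' where "\<phi>' n = \<phi> (SOME x. x \<in> \<Delta> \<and> \<rho> x = n)" for n
  note S' = add_subgroupD[OF \<Delta>(1)]
  have \<phi>': "\<phi>' (\<rho> x) = \<phi> x" if x: "x \<in> \<Delta>" for x
  proof -
    define y where "y = (SOME y. y \<in> \<Delta> \<and> \<rho> y = \<rho> x)"
    have y: "y \<in> \<Delta>" "\<rho> y = \<rho> x"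
      using someI_ex[of "\<lambda>y. y \<in> \<Delta> \<and> \<rho> y = \<rho> x"] x unfolding y_def by blast+
    then have "q (y - x) = 0"
      using \<rho>_eq x \<Delta>(2) by blast
    then have "p (\<phi> (y - x)) = 0"
      using \<phi>(2) S'(4) x y by simp
    then have "\<phi> y = \<phi> x"
      using \<phi>(1)[of "y - x" x] S'(4) x y by simp
    then show ?thesis
      by (simp add: \<phi>'_def y_def)
  qed
  have sub: "subgroup (\<rho> ` \<Delta>) H"
  proof (rule H.subgroupI)
    show "\<rho> ` \<Delta> \<subseteq> carrier H" "\<rho> ` \<Delta> \<noteq> {}"
      using \<Delta>(2) S'(1) by (auto simp: car)
    show "inv\<^bsub>H\<^esub> a \<in> \<rho> ` \<Delta>" if "a \<in> \<rho> ` \<Delta>" for a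
      using that inv S'(3) \<Delta>(2) by auto
    show "a \<otimes>\<^bsub>H\<^esub> b \<in> \<rho> ` \<Delta>" if "a \<in> \<rho> ` \<Delta>" "b \<in> \<rho> ` \<Delta>" for a b
      using that mult S'(2) \<Delta>(2) by (auto simp: subset_iff)
  qed
  have "\<exists>\<psi>::nat \<Rightarrow> 'a.
      (\<forall>x\<in>carrier H. \<forall>y\<in>carrier H. \<psi> (x \<otimes>\<^bsub>H\<^esub> y) = \<psi> x + \<psi> y) \<and>
      (\<forall>x\<in>\<rho> ` \<Delta>. p (\<phi>' x - \<psi> x) \<le> \<epsilon>) \<and>
      (\<forall>x\<in>carrier H. (1 - \<epsilon>) * qn x \<le> p (\<psi> x) \<and> p (\<psi> x) \<le> (1 + \<epsilon>) * qn x)"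
  proof (rule G2[unfolded prop_G2_def, rule_format], intro conjI)
    show "\<forall>x\<in>\<rho> ` \<Delta>. \<forall>y\<in>\<rho> ` \<Delta>. \<phi>' (x \<otimes>\<^bsub>H\<^esub> y) = \<phi>' x + \<phi>' y"
    proof safe
      fix x y assume "x \<in> \<Delta>" "y \<in> \<Delta>"
      then show "\<phi>' (\<rho> x \<otimes>\<^bsub>H\<^esub> \<rho> y) = \<phi>' (\<rho> x) + \<phi>' (\<rho> y)"
        using mult[of x y] \<phi>' \<phi>(1) S'(2) \<Delta>(2) by (auto simp: subset_iff)
    qed
    show "\<forall>x\<in>\<rho> ` \<Delta>. p (\<phi>' x) = qn x"
      using \<phi>' \<phi>(2) qn \<Delta>(2) by auto
  qed (use fin v e sub \<epsilon> le qn H.comm_group_axioms in \<open>auto simp: car\<close>)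
  then obtain \<psi> where \<psi>:
    "\<forall>x\<in>carrier H. \<forall>y\<in>carrier H. \<psi> (x \<otimes>\<^bsub>H\<^esub> y) = \<psi> x + \<psi> y"
    "\<forall>x\<in>\<rho> ` \<Delta>. p (\<phi>' x - \<psi> x) \<le> \<epsilon>"
    "\<forall>x\<in>carrier H. (1 - \<epsilon>) * qn x \<le> p (\<psi> x) \<and> p (\<psi> x) \<le> (1 + \<epsilon>) * qn x"
    by blast
  show ?thesis
  proof (intro exI[of _ "\<lambda>x. \<psi> (\<rho> x)"] conjI ballI)
    fix x y assume "x \<in> \<Gamma>" "y \<in> \<Gamma>"
    then show "\<psi> (\<rho> (x + y)) = \<psi> (\<rho> x) + \<psi> (\<rho> y)"
      using \<psi>(1) mult[of x y] by (metis car imageI)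
  next
    fix x assume "x \<in> \<Delta>"
    then show "p (\<phi> x - \<psi> (\<rho> x)) \<le> \<epsilon>"
      using \<psi>(2) \<phi>' by auto
  next
    fix x assume "x \<in> \<Gamma>"
    then show "(1 - \<epsilon>) * q x \<le> p (\<psi> (\<rho> x))" "p (\<psi> (\<rho> x)) \<le> (1 + \<epsilon>) * q x"
      using \<psi>(3) qn by (auto simp: car)
  qed
qed

section \<open>Truncation at the bound \<open>r\<close>\<close>

definition cap :: "ereal \<Rightarrow> real \<Rightarrow> real" where
  "cap r t = (if r = \<infinity> then t else min t (real_of_ereal r))"

context
  fixes r :: ereal
  assumes r: "0 \<le> r"
begin

lemma cap_le: "cap r t \<le> t"
  by (simp add: cap_def)

lemma cap_le_bound: "ereal (cap r t) \<le> r"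
  using r by (cases r) (auto simp: cap_def)

lemma cap_mono: "s \<le> t \<Longrightarrow> cap r s \<le> cap r t"
  by (auto simp: cap_def)

lemma cap_nonneg: "0 \<le> t \<Longrightarrow> 0 \<le> cap r t"
  using r by (cases r) (auto simp: cap_def)

lemma cap_eq: "ereal t \<le> r \<Longrightarrow> cap r t = t"
  using r by (cases r) (auto simp: cap_def)

text \<open>If either term on the right is truncated, the right-hand side is already at least
  \<open>r\<close>. Hence truncation at \<open>r\<close> keeps the triangle inequality.\<close>

lemma cap_add: "0 \<le> s \<Longrightarrow> 0 \<le> t \<Longrightarrow> cap r (s + t) \<le> cap r s + cap r t"
  using r by (cases r) (auto simp: cap_def min_def)

end

section \<open>Extensions by a cyclic group\<close>

lemma fst_gmul [simp]: "fst (gmul n z) = gmul n (fst z)"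
  by (induction n) auto

lemma snd_gmul [simp]: "snd (gmul n (z :: 'a::ab_group_add \<times> int)) = int n * snd z"
  by (induction n) (auto simp: algebra_simps)

lemma add_subgroup_UNIV [simp]: "add_subgroup UNIV"
  by (simp add: add_subgroup_def)

lemma pvalue_on_gmul_eq_0:
  assumes "pvalue_on UNIV q" "q z = 0"
  shows "q (gmul n z) = 0"
proof (induction n)
  case (Suc n)
  then show ?case
    using pvalue_onD(2,4)[OF assms(1)] assms(2) by (smt (verit) UNIV_I gmul_Suc)
qed (use pvalue_onD(1)[OF assms(1)] in simp)

lemma pvalue_on_cong:
  assumes "pvalue_on UNIV q" "q (x - y) = 0"
  shows "q x = q y"
  using pvalue_on_diff(1,2)[OF add_subgroup_UNIV assms(1), of x y]
    pvalue_on_diff(2)[OF add_subgroup_UNIV assms(1), of y x] assms(2) by simp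

section \<open>Integer multiples and finite subgroups generated by torsion elements\<close>

definition zmul :: "int \<Rightarrow> 'a::ab_group_add \<Rightarrow> 'a" where
  "zmul m a = gmul (nat m) a - gmul (nat (- m)) a"

lemma zmul_diff: "zmul (int i - int j) a = gmul i a - gmul j a"
proof -
  have "gmul k a = gmul l a + gmul (k - l) a" if "l \<le> k" for k l
    using gmul_add[of l "k - l" a] that by simp
  from this[of i j] this[of j i] show ?thesis
    by (cases "i \<le> j") (auto simp: zmul_def nat_diff_distrib algebra_simps simp flip: of_nat_diff)
qed

lemma zmul_add: "zmul (m + n) a = zmul m a + zmul n a"
proof -
  obtain i j k l where "m = int i - int j" "n = int k - int l"
    by (metis int_diff_cases)
  moreover from this have "m + n = int (i + k) - int (j + l)"
    by simp
  ultimately show ?thesis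
    by (simp only: zmul_diff gmul_add) (simp add: algebra_simps)
qed

context
  fixes \<beta> :: "int \<Rightarrow> 'a::ab_group_add"
  assumes \<beta>: "\<And>m n. \<beta> (m + n) = \<beta> m + \<beta> n"
begin

lemma additive_int_zero: "\<beta> 0 = 0"
  using \<beta>[of 0 0] by simp

lemma additive_int_minus: "\<beta> (- m) = - \<beta> m"
  using \<beta>[of m "- m"] additive_int_zero by (simp add: eq_neg_iff_add_eq_0 add.commute)

lemma additive_int_mod:
  assumes "\<beta> (int M) = 0"
  shows "\<beta> (m mod int M) = \<beta> m"
proof -
  have n: "\<beta> (int M * int k) = 0" for k
    by (induction k) (auto simp: additive_int_zero \<beta> assms algebra_simps)
  have "\<beta> (int M * j) = 0" for j
    using n additive_int_minus by (cases j rule: int_cases2) (auto simp del: of_nat_mult)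
  then show ?thesis
    by (metis \<beta> add.right_neutral mod_mult_div_eq)
qed

text \<open>\<open>\<beta>\<close> describes the cyclic group generated by \<open>\<beta> 1\<close>;
  since \<open>\<beta> (int M) = 0\<close>, reducing \<open>m\<close> modulo \<open>M\<close> leaves
  finitely many elements.\<close>

lemma finite_subgroup_extend:
  assumes K: "finite K" "add_subgroup K" and M: "\<beta> (int M) = 0" "M > 0"
  shows "finite {x + \<beta> m | x m. x \<in> K}" "add_subgroup {x + \<beta> m | x m. x \<in> K}"
proof -
  have "{x + \<beta> m | x m. x \<in> K} \<subseteq> (\<lambda>(x, m). x + \<beta> m) ` (K \<times> {0..<int M})"
  proof safe
    fix x m assume "x \<in> K"
    then show "x + \<beta> m \<in> (\<lambda>(x, m). x + \<beta> m) ` (K \<times> {0..<int M})"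
      using additive_int_mod[OF M(1), of m] M(2) by (auto intro!: image_eqI[of _ _ "(x, m mod int M)"])
  qed
  then show "finite {x + \<beta> m | x m. x \<in> K}"
    by (rule finite_subset) (use K in auto)
  note S = add_subgroupD[OF K(2)]
  show "add_subgroup {x + \<beta> m | x m. x \<in> K}"
    unfolding add_subgroup_def
  proof (intro conjI ballI)
    show "0 \<in> {x + \<beta> m | x m. x \<in> K}"
      using S(1) additive_int_zero by force
  next
    fix y z assume "y \<in> {x + \<beta> m | x m. x \<in> K}" "z \<in> {x + \<beta> m | x m. x \<in> K}"
    then obtain x m x' m' where "y = x + \<beta> m" "z = x' + \<beta> m'" "x \<in> K" "x' \<in> K"
      by auto
    then have "y + z = (x + x') + \<beta> (m + m')" "x + x' \<in> K"
      using S(2) by (auto simp: \<beta> algebra_simps)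
    then show "y + z \<in> {x + \<beta> m | x m. x \<in> K}"
      by blast
  next
    fix y assume "y \<in> {x + \<beta> m | x m. x \<in> K}"
    then obtain x m where "y = x + \<beta> m" "x \<in> K"
      by auto
    then have "- y = - x + \<beta> (- m)" "- x \<in> K"
      using S(3) by (auto simp: additive_int_minus)
    then show "- y \<in> {x + \<beta> m | x m. x \<in> K}"
      by blast
  qed
qed

end

text \<open>The elements of \<open>A\<close> are adjoined one at a time; each contributes a finite
  cyclic group.\<close>

lemma finite_subgroup_exists:
  fixes A :: "'a::ab_group_add set"
  assumes "finite A" "\<And>a. a \<in> A \<Longrightarrow> \<exists>n>0. gmul n a = 0"
  shows "\<exists>K. A \<subseteq> K \<and> finite K \<and> add_subgroup K"
  using assms
proof (induction A rule: finite_induct)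
  case empty
  show ?case
    by (rule exI[of _ "{0}"]) (simp add: add_subgroup_def)
next
  case (insert a A)
  then obtain K where K: "A \<subseteq> K" "finite K" "add_subgroup K"
    by blast
  obtain n where n: "n > 0" "gmul n a = 0"
    using insert.prems by blast
  let ?K = "{x + zmul m a | x m. x \<in> K}"
  have "0 \<in> K"
    using K(3) by (rule add_subgroupD)
  have "a = 0 + zmul 1 a" "\<And>x. x = x + zmul 0 a"
    by (simp_all add: zmul_def gmul_def)
  then have "insert a A \<subseteq> ?K"
    using \<open>0 \<in> K\<close> K(1) by blast
  moreover have "zmul (int n) a = 0"
    using n by (simp add: zmul_def)
  ultimately show ?case
    using finite_subgroup_extend[of "\<lambda>m. zmul m a", OF zmul_add K(2,3) _ n(1)] by blast
qed

section \<open>Pseudo-values on the direct sum with a cyclic group, and their realisation\<close>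

context valued
begin

text \<open>The pair \<open>(x, m)\<close> stands for \<open>x + m b\<close>, where \<open>b\<close> is a new generator of order \<open>M\<close>.\<close>

definition extends :: "ereal \<Rightarrow> nat \<Rightarrow> ('a \<times> int \<Rightarrow> real) \<Rightarrow> bool" where
  "extends r M q \<longleftrightarrow> pvalue_on UNIV q \<and> (\<forall>x. q (x, 0) = p x) \<and> q (0, int M) = 0 \<and>
     (\<forall>z. ereal (q z) \<le> r)"

text \<open>\<open>W x m\<close> is meant as the set of costs of words for \<open>x + m b\<close>.
  Combining words makes the infimum subadditive, \<open>W_p\<close> keeps it equal to
  \<open>p\<close> on the old group, and truncation enforces the bound \<open>r\<close>.
  \<open>W_add\<close> is an inequality because the combined word may be cheaper.\<close>

lemma extends_Inf:
  fixes W :: "'a \<Rightarrow> int \<Rightarrow> real set"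
  assumes r: "0 \<le> r" and p: "\<And>x. ereal (p x) \<le> r"
    and ne: "\<And>x m. W x m \<noteq> {}" and W_nonneg: "\<And>x m u. u \<in> W x m \<Longrightarrow> 0 \<le> u"
    and W_minus: "\<And>x m u. u \<in> W x m \<Longrightarrow> u \<in> W (- x) (- m)"
    and W_add: "\<And>x m u y n v. u \<in> W x m \<Longrightarrow> v \<in> W y n \<Longrightarrow> \<exists>w\<in>W (x + y) (m + n). w \<le> u + v"
    and W_M: "0 \<in> W 0 (int M)" and W_p: "\<And>x. p x \<in> W x 0" "\<And>x u. u \<in> W x 0 \<Longrightarrow> p x \<le> u"
  shows "extends r M (\<lambda>(x, m). cap r (Inf (W x m)))"
proof -
  have lower: "Inf (W x m) \<le> u" if "u \<in> W x m" for x m u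
    by (rule cInf_lower[OF that bdd_belowI]) (rule W_nonneg)
  have greatest: "c \<le> Inf (W x m)" if "\<And>u. u \<in> W x m \<Longrightarrow> c \<le> u" for c x m
    using ne that by (rule cInf_greatest)
  have nonneg: "0 \<le> Inf (W x m)" for x m
    using W_nonneg by (rule greatest)
  have "W (- x) (- m) = W x m" for x m
    using W_minus[of _ x m] W_minus[of _ "- x" "- m"] by auto
  then have minus: "Inf (W (- x) (- m)) = Inf (W x m)" for x m
    by simp
  have add: "Inf (W (x + y) (m + n)) \<le> Inf (W x m) + Inf (W y n)" for x y m n
  proof -
    have "Inf (W (x + y) (m + n)) - v \<le> Inf (W x m)" if v: "v \<in> W y n" for v
    proof (rule greatest)
      fix u assume "u \<in> W x m"
      from W_add[OF this v] obtain w where "w \<in> W (x + y) (m + n)" "w \<le> u + v" by blast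
      then show "Inf (W (x + y) (m + n)) - v \<le> u"
        using lower[of w "x + y" "m + n"] by simp
    qed
    then have "Inf (W (x + y) (m + n)) - Inf (W x m) \<le> Inf (W y n)"
      by (intro greatest) (simp add: algebra_simps)
    then show ?thesis by simp
  qed
  have eq_p: "Inf (W x 0) = p x" for x
    using lower[OF W_p(1)] greatest[OF W_p(2)] by (simp add: antisym)
  have M: "Inf (W 0 (int M)) = 0"
    using lower[OF W_M] nonneg[of 0 "int M"] by simp
  have sub: "cap r (Inf (W (x + y) (m + n))) \<le> cap r (Inf (W x m)) + cap r (Inf (W y n))" for x y m n
    using cap_mono[OF r add] cap_add[OF r nonneg nonneg] by (rule order_trans)
  show ?thesis
    unfolding extends_def pvalue_on_def
    using p cap_eq[OF r] cap_eq[OF r, of 0] r sub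
    by (auto simp: zero_prod_def zero_ereal_def eq_p M nonneg minus cap_nonneg cap_le_bound)
qed

text \<open>(G2) is applied to the product of \<open>K\<close> with the integers, with the
  pseudo-value \<open>q\<close> and the inclusion of \<open>K\<close>; \<open>\<beta> m\<close> is
  the image of \<open>(0, m)\<close>. Since \<open>q (0, int M) = 0\<close>, the quotient is finite
  and \<open>q\<close> is bounded, which turns the relative errors of (G2) into an absolute
  one.\<close>

lemma extends_approx:
  assumes G2: "prop_G2 r N p" and N: "N \<noteq> 0 \<Longrightarrow> M = N" "\<And>x. N \<noteq> 0 \<Longrightarrow> gmul N x = (0::'a)"
    and M: "M > 0" and q: "extends r M q" and K: "finite K" "add_subgroup K" and \<epsilon>: "\<epsilon> > 0"
  shows "\<exists>\<beta>. (\<forall>m n. \<beta> (m + n) = \<beta> m + \<beta> n) \<and> \<beta> (int M) = 0 \<and>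
    (\<forall>x\<in>K. \<forall>m. \<bar>p (x + \<beta> m) - q (x, m)\<bar> \<le> \<epsilon>)"
proof -
  have pq: "pvalue_on UNIV q" and qp: "\<And>x. q (x, 0) = p x" and qM: "q (0, int M) = 0"
    and qr: "\<And>z. ereal (q z) \<le> r"
    using q by (auto simp: extends_def)
  note P = pvalue_onD[OF pq, simplified] and S = add_subgroupD[OF K(2)]
  let ?\<Gamma> = "K \<times> (UNIV :: int set)" and ?T = "K \<times> {0..<int M}"
  have "q (0, int M * int n) = 0" for n
  proof -
    have "gmul n (0, int M) = (0::'a, int M * int n)"
      by (rule prod_eqI) auto
    then show ?thesis
      using pvalue_on_gmul_eq_0[OF pq qM, of n] by simp
  qed
  then have qMj: "q (0, int M * j) = 0" for j
    using P(3)[of "(0, int M * j)"] by (cases j rule: int_cases2) (auto simp del: of_nat_mult)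
  have T: "\<exists>t\<in>?T. q (z - t) = 0" if "z \<in> ?\<Gamma>" for z
  proof -
    have "z - (fst z, snd z mod int M) = (0, int M * (snd z div int M))"
      by (rule prod_eqI) (simp_all add: minus_mod_eq_mult_div)
    then show ?thesis
      using qMj that M by (intro bexI[of _ "(fst z, snd z mod int M)"]) auto
  qed
  define D where "D = Max (insert 0 (q ` ?T))"
  have D: "0 \<le> D" "\<And>t. t \<in> ?T \<Longrightarrow> q t \<le> D"
    unfolding D_def using K by auto
  have qD: "q z \<le> D" if z: "z \<in> ?\<Gamma>" for z
    using T[OF z] D(2) pvalue_on_cong[OF pq] by metis
  \<comment> \<open>Moving \<open>K\<close> costs at most \<open>e\<close>, and the relative error
    on values up to \<open>D\<close> costs at most \<open>e * D\<close>; the choice makes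
    \<open>e * (1 + D) \<le> \<epsilon>\<close>.\<close>
  define e where "e = min (1 / 2) (\<epsilon> / (1 + D))"
  have e: "0 < e" "e < 1" "e \<le> \<epsilon> / (1 + D)"
    using \<epsilon> D(1) by (auto simp: e_def)
  then have e_le: "e * (1 + D) \<le> \<epsilon>"
    using D(1) by (simp add: pos_le_divide_eq)
  have "\<exists>\<psi>. (\<forall>x\<in>?\<Gamma>. \<forall>y\<in>?\<Gamma>. \<psi> (x + y) = \<psi> x + \<psi> y) \<and> (\<forall>x\<in>K \<times> {0}. p (fst x - \<psi> x) \<le> e) \<and>
    (\<forall>x\<in>?\<Gamma>. (1 - e) * q x \<le> p (\<psi> x) \<and> p (\<psi> x) \<le> (1 + e) * q x)"
  proof (rule prop_G2_pseudo[OF G2 _ pvalue_on_mono[OF pq], where T = ?T])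
    show "q (gmul N z) = 0" if "N \<noteq> 0" for z
    proof -
      have "gmul N z = (0, int M * snd z)"
        using N that by (intro prod_eqI) auto
      then show ?thesis using qMj by simp
    qed
  qed (use S K T qr qp e in \<open>auto simp: add_subgroup_def zero_prod_def\<close>)
  then obtain \<psi> where \<psi>: "\<And>z w. z \<in> ?\<Gamma> \<Longrightarrow> w \<in> ?\<Gamma> \<Longrightarrow> \<psi> (z + w) = \<psi> z + \<psi> w"
    "\<And>x. x \<in> K \<Longrightarrow> p (x - \<psi> (x, 0)) \<le> e"
    "\<And>z. z \<in> ?\<Gamma> \<Longrightarrow> (1 - e) * q z \<le> p (\<psi> z)" "\<And>z. z \<in> ?\<Gamma> \<Longrightarrow> p (\<psi> z) \<le> (1 + e) * q z"
    by force
  show ?thesis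
  proof (intro exI[of _ "\<lambda>m. \<psi> (0, m)"] conjI allI ballI)
    show "\<psi> (0, m + n) = \<psi> (0, m) + \<psi> (0, n)" for m n
      using \<psi>(1)[of "(0, m)" "(0, n)"] S(1) by simp
    \<comment> \<open>The relative upper bound vanishes here, so the relation \<open>M b = 0\<close>
      holds exactly and not only approximately.\<close>
    have "p (\<psi> (0, int M)) \<le> 0"
      using \<psi>(4)[of "(0, int M)"] S(1) qM by simp
    then show "\<psi> (0, int M) = 0"
      using nonneg[of "\<psi> (0, int M)"] by (simp add: order_antisym_conv)
  next
    fix x m assume x: "x \<in> K"
    have "\<psi> (x, m) = \<psi> (x, 0) + \<psi> (0, m)"
      using \<psi>(1)[of "(x, 0)" "(0, m)"] x S(1) by simp
    then have "\<bar>p (x + \<psi> (0, m)) - p (\<psi> (x, m))\<bar> \<le> e"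
      using abs_diff[of "x + \<psi> (0, m)" "\<psi> (x, m)"] \<psi>(2)[OF x] by simp
    moreover have "\<bar>p (\<psi> (x, m)) - q (x, m)\<bar> \<le> e * q (x, m)"
      using \<psi>(3,4)[of "(x, m)"] x by (simp add: algebra_simps)
    moreover have "e * q (x, m) \<le> e * D"
      using qD[of "(x, m)"] x e by simp
    ultimately show "\<bar>p (x + \<psi> (0, m)) - q (x, m)\<bar> \<le> \<epsilon>"
      using e_le by (simp add: algebra_simps)
  qed
qed

text \<open>The new value is the infimum over \<open>k\<close> and \<open>j\<close> of the cost of writing \<open>y + m b\<close> as
  \<open>(y + k + \<beta> j) + (- k + (m - j) b) + (j b - \<beta> j)\<close>, where each nonzero \<open>j b - \<beta> j\<close> costs \<open>\<delta>\<close>.\<close>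

lemma extends_correction:
  assumes r: "0 \<le> r" "\<And>x. ereal (p x) \<le> r" and q: "extends r M q" and K: "add_subgroup K"
    and \<beta>: "\<And>m n. \<beta> (m + n) = \<beta> m + \<beta> n"
    and \<delta>: "\<And>x m. x \<in> K \<Longrightarrow> \<bar>p (x + \<beta> m) - q (x, m)\<bar> \<le> \<delta>"
  shows "\<exists>q'. extends r M q' \<and> (\<forall>x\<in>K. \<forall>m. q' (x, m) = q (x, m)) \<and> (\<forall>m. q' (- \<beta> m, m) \<le> \<delta>)"
proof -
  have pq: "pvalue_on UNIV q" and qp: "\<And>x. q (x, 0) = p x" and qM: "q (0, int M) = 0"
    and qr: "\<And>z. ereal (q z) \<le> r"
    using q by (auto simp: extends_def)
  note P = pvalue_onD[OF pq, simplified] and S = add_subgroupD[OF K]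
  have q_add: "q (x + y, m + n) \<le> q (x, m) + q (y, n)" for x y m n
    using P(4)[of "(x, m)" "(y, n)"] by simp
  have q_minus: "q (- x, - m) = q (x, m)" for x m
    using P(3)[of "(x, m)"] by simp
  have \<delta>0: "0 \<le> \<delta>"
    using \<delta>[OF S(1), of 0] by simp
  note \<beta>0 = additive_int_zero[of \<beta>, OF \<beta>] and \<beta>m = additive_int_minus[of \<beta>, OF \<beta>]
  define c where "c y m k j = p (y + k + \<beta> j) + q (- k, m - j) + (if j = 0 then 0 else \<delta>)" for y m k j
  define W where "W y m = {c y m k j | k j. k \<in> K}" for y m
  have W: "c y m k j \<in> W y m" if "k \<in> K" for y m k j
    using that by (auto simp: W_def)
  have c00: "c y m 0 0 = p y + q (0, m)" for y m
    by (simp add: c_def \<beta>0)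
  have ext: "extends r M (\<lambda>(x, m). cap r (Inf (W x m)))"
  proof (rule extends_Inf[OF r])
    show "W x m \<noteq> {}" for x m
      using W[OF S(1)] by blast
    show "0 \<le> u" if "u \<in> W x m" for x m u
      using that P(2) \<delta>0 by (auto simp: W_def c_def)
    show "u \<in> W (- x) (- m)" if u: "u \<in> W x m" for x m u
    proof -
      obtain k j where kj: "u = c x m k j" "k \<in> K"
        using u by (auto simp: W_def)
      have "p (- x - k + - \<beta> j) = p (x + k + \<beta> j)"
        using minus[of "x + k + \<beta> j"] by (metis add_uminus_conv_diff minus_add_distrib)
      then have "u = c (- x) (- m) (- k) (- j)"
        using q_minus[of "- k" "m - j"] kj by (simp add: c_def \<beta>m)
      then show ?thesis
        using W S(3) kj by blast
    qed
    show "\<exists>w\<in>W (x + y) (m + n). w \<le> u + v" if uv: "u \<in> W x m" "v \<in> W y n" for x m u y n v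
    proof -
      obtain k j k' j' where kj: "u = c x m k j" "k \<in> K" "v = c y n k' j'" "k' \<in> K"
        using uv by (auto simp: W_def)
      have "c (x + y) (m + n) (k + k') (j + j') \<le> u + v"
        using add[of "x + k + \<beta> j" "y + k' + \<beta> j'"] q_add[of "- k" "- k'" "m - j" "n - j'"] \<delta>0
        by (auto simp: kj c_def \<beta> algebra_simps)
      then show ?thesis
        using W S(2) kj by blast
    qed
    show "0 \<in> W 0 (int M)"
      using W[OF S(1), of 0 "int M" 0] by (simp add: c00 qM)
    show "p x \<in> W x 0" for x
      using W[OF S(1), of x 0 0] by (simp add: c00 qp)
    show "p x \<le> u" if u: "u \<in> W x 0" for x u
    proof -
      obtain k j where kj: "u = c x 0 k j" "k \<in> K"
        using u by (auto simp: W_def)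
      \<comment> \<open>By the bound \<open>\<delta>\<close>, the penalty for exchanging
        \<open>j b\<close> and \<open>\<beta> j\<close> is at least what the exchange can gain, so
        no word undercuts \<open>p\<close>.\<close>
      have "p (k + \<beta> j) \<le> q (- k, - j) + (if j = 0 then 0 else \<delta>)"
        using \<delta>[OF kj(2), of j] q_minus[of k j] qp[of k] by (auto simp: \<beta>0)
      then show ?thesis
        using diff_le[of x "x + k + \<beta> j"] minus[of "k + \<beta> j"] by (simp add: kj c_def)
    qed
  qed
  have bdd: "bdd_below (W y m)" for y m
    by (rule bdd_belowI[of _ 0]) (use P(2) \<delta>0 in \<open>auto simp: W_def c_def\<close>)
  show ?thesis
  proof (intro exI conjI ballI allI, rule ext)
    fix x m assume x: "x \<in> K"
    have "Inf (W x m) \<le> c x m (- x) 0"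
      by (rule cInf_lower[OF W bdd]) (use S(3) x in auto)
    moreover have "q (x, m) \<le> Inf (W x m)"
    proof (rule cInf_greatest)
      show "W x m \<noteq> {}"
        using W[OF S(1)] by blast
      fix u assume "u \<in> W x m"
      then obtain k j where kj: "u = c x m k j" "k \<in> K"
        by (auto simp: W_def)
      \<comment> \<open>The same comparison in the other direction: replacing
        \<open>\<beta> j\<close> by \<open>j b\<close> is paid for by the penalty, and the rest is
        subadditivity of \<open>q\<close>.\<close>
      have "q (x + k, j) \<le> p (x + k + \<beta> j) + (if j = 0 then 0 else \<delta>)"
        using \<delta>[of "x + k" j] S(2) x kj qp[of "x + k"] by (auto simp: \<beta>0)
      then show "q (x, m) \<le> u"
        using q_add[of "x + k" "- k" j "m - j"] by (simp add: kj c_def)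
    qed
    ultimately have "Inf (W x m) = q (x, m)"
      by (simp add: c_def \<beta>0)
    then show "(case (x, m) of (x, m) \<Rightarrow> cap r (Inf (W x m))) = q (x, m)"
      using cap_eq[OF r(1) qr] by simp
  next
    fix m
    \<comment> \<open>The word with \<open>k = 0\<close> and \<open>j = m\<close> consists of the
      correction \<open>m b - \<beta> m\<close> alone.\<close>
    have "Inf (W (- \<beta> m) m) \<le> c (- \<beta> m) m 0 m"
      by (rule cInf_lower[OF W[OF S(1)] bdd])
    also have "\<dots> \<le> \<delta>"
      using P(1) \<delta>0 by (simp add: c_def zero_prod_def)
    finally show "(case (- \<beta> m, m) of (x, m) \<Rightarrow> cap r (Inf (W x m))) \<le> \<delta>"
      using cap_le[OF r(1)] by (auto intro: order_trans)
  qed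
qed

lemma geometric_limit:
  assumes complete: "vg_complete p" and C: "\<And>n. p (u (Suc n) - u n) \<le> C * (1 / 2) ^ n"
  shows "\<exists>l. (\<lambda>n. p (u n - l)) \<longlonglongrightarrow> 0"
proof -
  have step: "p (u (n + k) - u n) \<le> C * (2 * (1 / 2) ^ n - 2 * (1 / 2) ^ (n + k))" for n k
  proof (induction k)
    case (Suc k)
    then show ?case
      using triangle[of "u (n + Suc k)" "u n" "u (n + k)"] C[of "n + k"] by (simp add: algebra_simps)
  qed simp
  have C0: "0 \<le> C"
    using order_trans[OF nonneg C[of 0]] by simp
  have bound: "p (u m - u n) \<le> 2 * C * (1 / 2) ^ n" if "n \<le> m" for m n
  proof -
    have "p (u m - u n) \<le> C * (2 * (1 / 2) ^ n - 2 * (1 / 2) ^ m)"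
      using step[of n "m - n"] that by simp
    also have "\<dots> \<le> C * (2 * (1 / 2) ^ n)"
      using C0 by (intro mult_left_mono) auto
    finally show ?thesis by simp
  qed
  have lim: "(\<lambda>n. 2 * C * (1 / 2) ^ n) \<longlonglongrightarrow> 0"
    by (intro tendsto_mult_right_zero LIMSEQ_realpow_zero) auto
  have "\<exists>n0. \<forall>m\<ge>n0. \<forall>n\<ge>n0. p (u m - u n) < e" if "e > 0" for e
  proof -
    from order_tendstoD(2)[OF lim \<open>e > 0\<close>] obtain n0 where n0: "\<And>n. n \<ge> n0 \<Longrightarrow> 2 * C * (1 / 2) ^ n < e"
      by (auto simp: eventually_sequentially)
    have "p (u m - u n) < e" if "m \<ge> n0" "n \<ge> n0" for m n
      using bound[of m n] bound[of n m] n0[OF that(1)] n0[OF that(2)] diff_commute[of "u m" "u n"]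
      by (cases "m \<le> n") auto
    then show ?thesis by blast
  qed
  with complete obtain l where l: "\<forall>e>0. \<exists>n0. \<forall>n\<ge>n0. p (u n - l) < e"
    unfolding vg_complete_def by metis
  have "(\<lambda>n. p (u n - l)) \<longlonglongrightarrow> 0"
    by (rule LIMSEQ_I) (use l in simp)
  then show ?thesis by blast
qed

lemma diff_tendsto:
  assumes "(\<lambda>n. p (u n - l)) \<longlonglongrightarrow> 0"
  shows "(\<lambda>n. p (x - u n)) \<longlonglongrightarrow> p (x - l)"
proof -
  have "\<bar>p (x - u n) - p (x - l)\<bar> \<le> p (u n - l)" for n
    using abs_diff[of "x - u n" "x - l"] diff_commute[of l "u n"] by simp
  then have "(\<lambda>n. p (x - u n) - p (x - l)) \<longlonglongrightarrow> 0"
    by (intro tendsto_rabs_zero_cancel[OF tendsto_sandwich[OF _ _ tendsto_const assms]]) auto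
  then show ?thesis
    by (rule LIM_zero_cancel)
qed

text \<open>Two independent approximations of \<open>q\<close> need not be close to each other. The
  correction gives a \<open>q'\<close> that agrees with \<open>q\<close> over \<open>K\<close> and
  puts \<open>m b\<close> within \<open>(1 / 2) ^ n\<close> of \<open>\<beta> m\<close>;
  approximating \<open>q'\<close> on the enlarged subgroup yields a better approximation that is
  also close to the old one. So the images of \<open>- b\<close> converge.\<close>

lemma extends_realized:
  assumes complete: "vg_complete p" and G2: "prop_G2 r N p"
    and N: "N \<noteq> 0 \<Longrightarrow> M = N" "\<And>x. N \<noteq> 0 \<Longrightarrow> gmul N x = (0::'a)" and M: "M > 0"
    and r: "0 \<le> r" "\<And>x. ereal (p x) \<le> r"
    and q: "extends r M q" and K: "finite K" "add_subgroup K"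
  shows "\<exists>b. \<forall>x\<in>K. p (x - b) = q (x, -1)"
proof -
  define P where "P n \<beta> \<longleftrightarrow> (\<forall>m n. \<beta> (m + n) = \<beta> m + \<beta> n) \<and> \<beta> (int M) = 0 \<and>
    (\<forall>x\<in>K. \<forall>m. \<bar>p (x + \<beta> m) - q (x, m)\<bar> \<le> (1 / 2) ^ n)" for n :: nat and \<beta>
  have "\<exists>f. \<forall>n. P n (f n) \<and> p (f (Suc n) (-1) - f n (-1)) \<le> 2 * (1 / 2) ^ n"
  proof (rule dependent_nat_choice)
    show "\<exists>\<beta>. P 0 \<beta>"
      using extends_approx[OF G2 N M q K, of 1] by (auto simp: P_def)
  next
    fix \<beta> n assume "P n \<beta>"
    then have \<beta>: "\<And>m n. \<beta> (m + n) = \<beta> m + \<beta> n" "\<beta> (int M) = 0"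
      and \<delta>: "\<And>x m. x \<in> K \<Longrightarrow> \<bar>p (x + \<beta> m) - q (x, m)\<bar> \<le> (1 / 2) ^ n"
      by (auto simp: P_def)
    obtain q' where q': "extends r M q'" "\<And>x m. x \<in> K \<Longrightarrow> q' (x, m) = q (x, m)"
      "\<And>m. q' (- \<beta> m, m) \<le> (1 / 2) ^ n"
      using extends_correction[OF r q K(2) \<beta>(1) \<delta>] by blast
    let ?K = "{x + \<beta> m | x m. x \<in> K}"
    have "\<exists>\<beta>'. (\<forall>m n. \<beta>' (m + n) = \<beta>' m + \<beta>' n) \<and> \<beta>' (int M) = 0 \<and>
      (\<forall>x\<in>?K. \<forall>m. \<bar>p (x + \<beta>' m) - q' (x, m)\<bar> \<le> (1 / 2) ^ Suc n)"
      by (rule extends_approx[OF G2 _ _ M q'(1) finite_subgroup_extend[OF \<beta>(1) K \<beta>(2) M]])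
        (use N in auto)
    then obtain \<beta>' where \<beta>': "\<forall>m n. \<beta>' (m + n) = \<beta>' m + \<beta>' n" "\<beta>' (int M) = 0"
      "\<forall>x\<in>?K. \<forall>m. \<bar>p (x + \<beta>' m) - q' (x, m)\<bar> \<le> (1 / 2) ^ Suc n"
      by (elim exE conjE) (rule that)
    have sub: "x \<in> ?K" "- \<beta> m \<in> ?K" if "x \<in> K" for x m
    proof -
      show "x \<in> ?K"
        using that additive_int_zero[of \<beta>, OF \<beta>(1)] by force
      have "- \<beta> m = 0 + \<beta> (- m)" "0 \<in> K"
        using additive_int_minus[of \<beta>, OF \<beta>(1)] add_subgroupD(1)[OF K(2)] by auto
      then show "- \<beta> m \<in> ?K" by blast
    qed
    have "P (Suc n) \<beta>'"
      unfolding P_def using \<beta>'(1,2) bspec[OF \<beta>'(3) sub(1)] q'(2) by simp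
    moreover have "p (\<beta>' (-1) - \<beta> (-1)) \<le> 2 * (1 / 2) ^ n"
    proof -
      \<comment> \<open>Taken at the element \<open>- \<beta> (-1)\<close>, the approximation
        property measures the distance between the new and the old image of
        \<open>- b\<close>.\<close>
      have "\<bar>p (\<beta>' (-1) - \<beta> (-1)) - q' (- \<beta> (-1), -1)\<bar> \<le> (1 / 2) ^ Suc n"
        using bspec[OF \<beta>'(3) sub(2)[of 0 "-1"], rule_format, of "-1"] add_subgroupD(1)[OF K(2)]
        by simp
      also have "(1 / 2) ^ Suc n \<le> (1 / 2 :: real) ^ n"
        by simp
      finally show ?thesis
        using q'(3)[of "-1"] by linarith
    qed
    ultimately show "\<exists>\<beta>'. P (Suc n) \<beta>' \<and> p (\<beta>' (-1) - \<beta> (-1)) \<le> 2 * (1 / 2) ^ n"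
      by blast
  qed
  then obtain f where f: "\<And>n. P n (f n)" "\<And>n. p (f (Suc n) (-1) - f n (-1)) \<le> 2 * (1 / 2) ^ n"
    by blast
  obtain l where l: "(\<lambda>n. p (f n (-1) - l)) \<longlonglongrightarrow> 0"
    using geometric_limit[OF complete, of "\<lambda>n. f n (-1)"] f(2) by blast
  \<comment> \<open>\<open>l\<close> is the limit of the images of \<open>- b\<close>, so the point
    sought is \<open>- l\<close>.\<close>
  have "p (x - - l) = q (x, -1)" if x: "x \<in> K" for x
  proof -
    have "(\<lambda>n. p (- x - f n (-1))) \<longlonglongrightarrow> p (- x - l)"
      using l by (rule diff_tendsto)
    moreover have "p (- x - y) = p (x + y)" for y
      using minus[of "x + y"] by (simp add: algebra_simps)
    ultimately have "(\<lambda>n. p (x + f n (-1))) \<longlonglongrightarrow> p (x + l)"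
      by simp
    moreover have "(\<lambda>n. p (x + f n (-1))) \<longlonglongrightarrow> q (x, -1)"
    proof (rule LIM_zero_cancel, rule Lim_null_comparison)
      show "\<forall>\<^sub>F n in sequentially. norm (p (x + f n (-1)) - q (x, -1)) \<le> (1 / 2) ^ n"
        using f(1) x by (auto simp: P_def)
      show "(\<lambda>n. (1 / 2) ^ n :: real) \<longlonglongrightarrow> 0"
        by (rule LIMSEQ_realpow_zero) auto
    qed
    ultimately show ?thesis
      using LIMSEQ_unique by auto
  qed
  then show ?thesis by blast
qed

end

section \<open>Triviality of Katetov maps\<close>

lemma sum_list_diff_const:
  "sum_list (map (\<lambda>x. x - b) xs) = sum_list xs - gmul (length xs) (b :: 'a::ab_group_add)"
  by (induction xs) (auto simp: algebra_simps)

lemma add_subgroup_sum_list: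
  "add_subgroup K \<Longrightarrow> set xs \<subseteq> K \<Longrightarrow> sum_list xs \<in> K"
  by (induction xs) (auto simp: add_subgroupD)

lemma sum_list_lower:
  fixes f :: "'a \<Rightarrow> real"
  shows "(\<And>x. x \<in> set xs \<Longrightarrow> c \<le> f x) \<Longrightarrow> real (length xs) * c \<le> sum_list (map f xs)"
  by (induction xs) (auto simp: algebra_simps intro: add_mono)

section \<open>Costs of words in the letters \<open>\<plusminus>(a - b)\<close>\<close>

context valued
begin

lemma sum_list_le: "p (sum_list xs) \<le> sum_list (map p xs)"
  by (induction xs) (auto intro: order_trans[OF add])

context
  fixes A :: "'a set" and f :: "'a \<Rightarrow> real" and M :: nat
  assumes kat: "katetov_on p A f" and M: "M \<ge> 2"
    and C1: "\<And>xs. set xs \<subseteq> A \<Longrightarrow> length xs = M \<Longrightarrow> p (sum_list xs) \<le> sum_list (map f xs)"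
    and C2: "\<And>a ys. a \<in> A \<Longrightarrow> set ys \<subseteq> A \<Longrightarrow> Suc (length ys) = M \<Longrightarrow>
      f a \<le> p (a + sum_list ys) + sum_list (map f ys)"
begin

text \<open>The word is cut into blocks of length \<open>M\<close>, to each of which
  \<open>C1\<close> applies.\<close>

lemma katetov_pos_words:
  assumes "set xs \<subseteq> A" "M dvd length xs"
  shows "p (sum_list xs) \<le> sum_list (map f xs)"
  using assms
proof (induction "length xs" arbitrary: xs rule: less_induct)
  case less
  show ?case
  proof (cases "xs = []")
    case False
    then have len: "M \<le> length xs"
      using less.prems by (simp add: dvd_imp_le)
    have sub: "set (take M xs) \<subseteq> A" "set (drop M xs) \<subseteq> A"
      using less.prems(1) set_take_subset[of M xs] set_drop_subset[of M xs] by auto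
    have "p (sum_list (drop M xs)) \<le> sum_list (map f (drop M xs))"
      by (rule less.hyps) (use sub less.prems len M False in \<open>auto simp: dvd_diff_nat\<close>)
    moreover have "p (sum_list (take M xs)) \<le> sum_list (map f (take M xs))"
      by (rule C1) (use sub len in auto)
    moreover have "sum_list xs = sum_list (take M xs) + sum_list (drop M xs)"
      "sum_list (map f xs) = sum_list (map f (take M xs)) + sum_list (map f (drop M xs))"
      by (metis append_take_drop_id sum_list_append) (metis append_take_drop_id map_append sum_list_append)
    ultimately show ?thesis
      using add[of "sum_list (take M xs)" "sum_list (drop M xs)"] by simp
  qed simp
qed

text \<open>Letters of opposite sign are paired off, each pair being paid for by
  \<open>p (x - y) \<le> f x + f y\<close>; the remaining letters have one sign and split into
  blocks. This keeps the new value equal to \<open>p\<close> on the old group.\<close>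

lemma katetov_words:
  assumes "set xs \<subseteq> A" "set ys \<subseteq> A" "int M dvd int (length xs) - int (length ys)"
  shows "p (sum_list xs - sum_list ys) \<le> sum_list (map f xs) + sum_list (map f ys)"
  using assms
proof (induction xs ys rule: list_induct2')
  case (4 x xs y ys)
  then have "p (sum_list xs - sum_list ys) \<le> sum_list (map f xs) + sum_list (map f ys)"
    by auto
  moreover have "p (x - y) \<le> f x + f y"
    using kat 4 by (auto simp: katetov_on_def)
  ultimately show ?case
    using add[of "x - y" "sum_list xs - sum_list ys"] by (simp add: algebra_simps)
next
  case (2 x xs)
  then have "M dvd length (x # xs)"
    by (metis diff_zero int_dvd_int_iff list.size(3) of_nat_0)
  with 2 show ?case
    using katetov_pos_words[of "x # xs"] by simp
next
  case (3 y ys)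
  then have "M dvd length (y # ys)"
    by (metis diff_0 dvd_minus_iff int_dvd_int_iff list.size(3) of_nat_0)
  with 3 show ?case
    using katetov_pos_words[of "y # ys"] minus[of "y + sum_list ys"] by simp
qed simp

text \<open>This keeps the new value at \<open>a - b\<close> from dropping below \<open>f a\<close>.
  Once opposite signs are paired off, only \<open>xs\<close> or only \<open>ys\<close> is left. In
  the first case one letter is compared with \<open>a\<close> by the Lipschitz inequality, in the
  second \<open>C2\<close> absorbs \<open>M - 1\<close> letters; blocks of length \<open>M\<close>
  remain.\<close>

lemma katetov_shifted_words:
  assumes "a \<in> A" "set xs \<subseteq> A" "set ys \<subseteq> A" "int M dvd int (length xs) - int (length ys) - 1"
  shows "f a \<le> p (a - sum_list xs + sum_list ys) + sum_list (map f xs) + sum_list (map f ys)"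
  using assms
proof (induction xs ys rule: list_induct2')
  \<comment> \<open>Without letters \<open>M\<close> would divide \<open>-1\<close>, which
    \<open>M \<ge> 2\<close> excludes.\<close>
  case 1
  then show ?case
    using M by auto
next
  case (4 x xs y ys)
  then have "f a \<le> p (a - sum_list xs + sum_list ys) + sum_list (map f xs) + sum_list (map f ys)"
    by auto
  moreover have "p (x - y) \<le> f x + f y"
    using kat 4 by (auto simp: katetov_on_def)
  ultimately show ?case
    using add[of "x - y" "a - sum_list (x # xs) + sum_list (y # ys)"] by (simp add: algebra_simps)
next
  case (2 x xs)
  then have "M dvd length xs"
    by simp
  then have "p (sum_list xs) \<le> sum_list (map f xs)"
    using katetov_pos_words 2 by simp
  moreover have "f a \<le> f x + p (a - x)"
    using kat 2 by (force simp: katetov_on_def)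
  ultimately show ?case
    using diff_le[of "a - x" "a - x - sum_list xs"] by (simp add: algebra_simps)
next
  case (3 y ys)
  let ?zs = "y # ys"
  have dvd: "M dvd Suc (length ?zs)"
    using 3 by (metis add.commute diff_0 dvd_minus_iff int_dvd_int_iff list.size(3) minus_diff_eq
        of_nat_0 of_nat_Suc diff_minus_eq_add minus_add_distrib uminus_add_conv_diff)
  then have len: "M \<le> Suc (length ?zs)"
    by (simp add: dvd_imp_le)
  have sub: "set (take (M - 1) ?zs) \<subseteq> A" "set (drop (M - 1) ?zs) \<subseteq> A"
    using 3 set_take_subset[of "M - 1" ?zs] set_drop_subset[of "M - 1" ?zs] by auto
  have "length (drop (M - 1) ?zs) = Suc (length ?zs) - M"
    using M by simp
  then have "M dvd length (drop (M - 1) ?zs)"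
    using dvd by (simp only: dvd_diff_nat dvd_refl)
  then have "p (sum_list (drop (M - 1) ?zs)) \<le> sum_list (map f (drop (M - 1) ?zs))"
    using katetov_pos_words sub by blast
  moreover have "f a \<le> p (a + sum_list (take (M - 1) ?zs)) + sum_list (map f (take (M - 1) ?zs))"
    by (rule C2) (use 3 sub len M in auto)
  moreover have "sum_list ?zs = sum_list (take (M - 1) ?zs) + sum_list (drop (M - 1) ?zs)"
    "sum_list (map f ?zs) = sum_list (map f (take (M - 1) ?zs)) + sum_list (map f (drop (M - 1) ?zs))"
    by (metis append_take_drop_id sum_list_append) (metis append_take_drop_id map_append sum_list_append)
  moreover note diff_le[of "a + sum_list (take (M - 1) ?zs)" "a + sum_list ?zs"]
    minus[of "sum_list (drop (M - 1) ?zs)"]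
  ultimately show ?case
    by (simp del: sum_list.Cons list.map(2))
qed

text \<open>The pair of lists \<open>xs\<close>, \<open>ys\<close> encodes the word
  \<open>x + m b = (x - \<Sum>xs + \<Sum>ys) + \<Sum>(xs - b) - \<Sum>(ys - b)\<close>, which requires \<open>length ys - length xs \<equiv> m\<close> modulo \<open>M\<close>.\<close>

lemma katetov_extends:
  assumes r: "\<And>x. ereal (p x) \<le> r" "\<And>a. a \<in> A \<Longrightarrow> ereal (f a) \<le> r" and A: "A \<noteq> {}"
  shows "\<exists>q. extends r M q \<and> (\<forall>a\<in>A. q (a, -1) = f a)"
proof -
  have r0: "0 \<le> r"
    using r(1)[of 0] by (simp add: zero_ereal_def)
  define c where "c x xs ys = p (x - sum_list xs + sum_list ys) + sum_list (map f xs) + sum_list (map f ys)"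
    for x xs ys
  define W where "W x m = {c x xs ys | xs ys. set xs \<subseteq> A \<and> set ys \<subseteq> A \<and>
    int M dvd int (length ys) - int (length xs) - m}" for x m
  have f0: "0 \<le> sum_list (map f xs)" if "set xs \<subseteq> A" for xs
    by (rule sum_list_nonneg) (use kat that in \<open>auto simp: katetov_on_def\<close>)
  have W_nonneg: "0 \<le> u" if "u \<in> W x m" for x m u
    using that f0 by (auto simp: W_def c_def)
  have WI: "c x xs ys \<in> W x m"
    if "set xs \<subseteq> A" "set ys \<subseteq> A" "int M dvd int (length ys) - int (length xs) - m" for x m xs ys
    using that by (auto simp: W_def)
  \<comment> \<open>Any coefficient \<open>m\<close> is reached with copies of a single point of
    \<open>A\<close>.\<close>
  have ne: "W x m \<noteq> {}" for x m
  proof -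
    obtain a where "a \<in> A" using A by blast
    moreover obtain i j where "m = int i - int j"
      by (rule int_diff_cases)
    ultimately have "c x (replicate j a) (replicate i a) \<in> W x m"
      by (intro WI) (auto simp: set_replicate_conv_if)
    then show ?thesis by blast
  qed
  have ext: "extends r M (\<lambda>(x, m). cap r (Inf (W x m)))"
  proof (rule extends_Inf[OF r0 r(1) ne])
    show "0 \<le> u" if "u \<in> W x m" for x m u
      using that by (rule W_nonneg)
    show "u \<in> W (- x) (- m)" if "u \<in> W x m" for x m u
    proof -
      from that obtain xs ys where xy: "u = c x xs ys" "set xs \<subseteq> A" "set ys \<subseteq> A"
        "int M dvd int (length ys) - int (length xs) - m"
        by (auto simp: W_def)
      have "c (- x) ys xs = u"
        using minus[of "x - sum_list xs + sum_list ys"] by (simp add: c_def xy(1) algebra_simps)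
      moreover have "int M dvd int (length xs) - int (length ys) - - m"
        using dvd_minus_iff[THEN iffD2, OF xy(4)] by (simp add: algebra_simps)
      ultimately show ?thesis
        using WI[OF xy(3,2)] by metis
    qed
    show "\<exists>w\<in>W (x + y) (m + n). w \<le> u + v" if uv: "u \<in> W x m" "v \<in> W y n" for x m u y n v
    proof -
      obtain xs ys where xy: "u = c x xs ys" "set xs \<subseteq> A" "set ys \<subseteq> A"
        "int M dvd int (length ys) - int (length xs) - m"
        using uv by (auto simp: W_def)
      obtain xs' ys' where xy': "v = c y xs' ys'" "set xs' \<subseteq> A" "set ys' \<subseteq> A"
        "int M dvd int (length ys') - int (length xs') - n"
        using uv by (auto simp: W_def)
      have "c (x + y) (xs @ xs') (ys @ ys') \<le> u + v"
        using add[of "x - sum_list xs + sum_list ys" "y - sum_list xs' + sum_list ys'"]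
        by (simp add: c_def xy(1) xy'(1) algebra_simps)
      moreover have "c (x + y) (xs @ xs') (ys @ ys') \<in> W (x + y) (m + n)"
        by (rule WI) (use xy xy' dvd_add[OF xy(4) xy'(4)] in \<open>auto simp: algebra_simps\<close>)
      ultimately show ?thesis by blast
    qed
    show "0 \<in> W 0 (int M)"
      using WI[of "[]" "[]" "int M" 0] by (simp add: c_def)
    show "p x \<in> W x 0" for x
      using WI[of "[]" "[]" 0 x] by (simp add: c_def)
    show "p x \<le> u" if "u \<in> W x 0" for x u
    proof -
      from that obtain xs ys where xy: "u = c x xs ys" "set xs \<subseteq> A" "set ys \<subseteq> A"
        "int M dvd int (length ys) - int (length xs)"
        by (auto simp: W_def)
      then show ?thesis
        using katetov_words[OF xy(3,2,4)] diff_le[of x "x - sum_list xs + sum_list ys"]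
          diff_commute[of "sum_list xs" "sum_list ys"]
        by (simp add: c_def)
    qed
  qed
  have "cap r (Inf (W a (-1))) = f a" if a: "a \<in> A" for a
  proof -
    \<comment> \<open>The word with the single letter \<open>a - b\<close> costs exactly
      \<open>f a\<close>.\<close>
    have "Inf (W a (-1)) \<le> c a [a] []"
      by (intro cInf_lower bdd_belowI WI) (use a W_nonneg in auto)
    moreover have "f a \<le> Inf (W a (-1))"
    proof (rule cInf_greatest[OF ne])
      fix u assume "u \<in> W a (-1)"
      then obtain xs ys where xy: "u = c a xs ys" "set xs \<subseteq> A" "set ys \<subseteq> A"
        "int M dvd int (length ys) - int (length xs) - (-1)"
        by (auto simp: W_def)
      have "int M dvd int (length xs) - int (length ys) - 1"
        using dvd_minus_iff[THEN iffD2, OF xy(4)] by (simp add: algebra_simps)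
      then show "f a \<le> u"
        using katetov_shifted_words[OF a xy(2,3)] by (simp add: xy(1) c_def)
    qed
    ultimately show ?thesis
      using cap_eq[OF r0 r(2)[OF a]] by (simp add: c_def)
  qed
  with ext show ?thesis
    by (intro exI[of _ "\<lambda>(x, m). cap r (Inf (W x m))"]) auto
qed

end

end

section \<open>Katetov maps on finite subsets of the universal groups\<close>

lemma is_GG_D:
  fixes p :: "'a::ab_group_add \<Rightarrow> real"
  assumes "is_GG r N p"
  shows "valued p" "vg_complete p" "vg_separable p" "prop_G2 r N p" "\<And>x. ereal (p x) \<le> r" "0 \<le> r"
    "\<And>x. N \<noteq> 0 \<Longrightarrow> gmul N x = (0::'a)"
proof -
  show v: "valued p" and "vg_complete p" "vg_separable p" "prop_G2 r N p"
    and le: "\<And>x. ereal (p x) \<le> r" and "\<And>x. N \<noteq> 0 \<Longrightarrow> gmul N x = (0::'a)"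
    using assms by (auto simp: is_GG_def in_frakG_def has_exponent_def valued_def)
  show "0 \<le> r"
    using le[of 0] valued.zero[OF v] by (simp add: zero_ereal_def)
qed

lemma E_rD:
  assumes "f \<in> E_r r p A"
  shows "katetov_on p A f" "\<And>a. a \<in> A \<Longrightarrow> 0 \<le> f a" "\<And>a. a \<in> A \<Longrightarrow> ereal (f a) \<le> r"
    "\<And>a b. a \<in> A \<Longrightarrow> b \<in> A \<Longrightarrow> \<bar>f a - f b\<bar> \<le> p (a - b)"
    "\<And>a b. a \<in> A \<Longrightarrow> b \<in> A \<Longrightarrow> p (a - b) \<le> f a + f b"
  using assms by (auto simp: E_r_def katetov_on_def)

lemma E_r_mono: "f \<in> E_r r p A \<Longrightarrow> B \<subseteq> A \<Longrightarrow> f \<in> E_r r p B"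
  by (auto simp: E_r_def katetov_on_def subset_iff)

lemma trivial_in_empty [simp]: "trivial_in p {} f"
  by (simp add: trivial_in_def)

lemma trivial_in_mono: "trivial_in p A f \<Longrightarrow> B \<subseteq> A \<Longrightarrow> trivial_in p B f"
  by (auto simp: trivial_in_def)

text \<open>The new generator gets order \<open>M = N\<close>, as the exponent in (G2) requires. All
  elements are torsion, so \<open>A\<close> lies in a finite subgroup, over which the generator is
  realised.\<close>

lemma is_GG_katetov_trivial:
  assumes GG: "is_GG r N p" and N: "N \<ge> 2" and A: "finite A" and f: "f \<in> E_r r p A"
    and C1: "\<And>xs. set xs \<subseteq> A \<Longrightarrow> length xs = N \<Longrightarrow> p (sum_list xs) \<le> sum_list (map f xs)"
    and C2: "\<And>a ys. a \<in> A \<Longrightarrow> set ys \<subseteq> A \<Longrightarrow> Suc (length ys) = N \<Longrightarrow>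
      f a \<le> p (a + sum_list ys) + sum_list (map f ys)"
  shows "trivial_in p A f"
proof (cases "A = {}")
  case False
  note G = is_GG_D[OF GG]
  interpret valued p by (rule G(1))
  obtain q where q: "extends r N q" "\<And>a. a \<in> A \<Longrightarrow> q (a, -1) = f a"
    using katetov_extends[OF E_rD(1)[OF f] N C1 C2 G(5) E_rD(3)[OF f] False] by blast
  have "\<exists>n>0. gmul n a = 0" for a :: 'a
    using G(7)[of a] N by (intro exI[of _ N]) auto
  then obtain K where K: "A \<subseteq> K" "finite K" "add_subgroup K"
    using finite_subgroup_exists[OF A] by blast
  obtain b where "\<forall>x\<in>K. p (x - b) = q (x, -1)"
    using extends_realized[OF G(2,4) _ G(7) _ G(6,5) q(1) K(2,3)] N by auto
  then show ?thesis
    using q(2) K(1) unfolding trivial_in_def by (metis subsetD)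
qed simp

text \<open>Each instance of the two word inequalities involves at most \<open>N\<close> points. For
  these a realising point \<open>b\<close> exists, and because \<open>N b = 0\<close> the inequality
  is a triangle inequality between the elements \<open>x - b\<close>.\<close>

lemma is_GG_trivial_if_small_trivial:
  assumes GG: "is_GG r N p" and N: "N \<ge> 2" and A: "finite A" and f: "f \<in> E_r r p A"
    and small: "\<And>B. B \<subseteq> A \<Longrightarrow> B \<noteq> {} \<Longrightarrow> card B \<le> N \<Longrightarrow> trivial_in p B f"
  shows "trivial_in p A f"
proof (rule is_GG_katetov_trivial[OF GG N A f])
  note G = is_GG_D[OF GG]
  interpret valued p by (rule G(1))
  fix xs assume xs: "set xs \<subseteq> A" "length xs = N"
  then have "trivial_in p (set xs) f"
    using small[of "set xs"] card_length[of xs] N by fastforce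
  then obtain b where b: "\<And>x. x \<in> set xs \<Longrightarrow> f x = p (x - b)"
    by (auto simp: trivial_in_def)
  have "sum_list xs = sum_list (map (\<lambda>x. x - b) xs)"
    using G(7)[of b] N xs by (simp add: sum_list_diff_const)
  also have "p \<dots> \<le> sum_list (map p (map (\<lambda>x. x - b) xs))"
    by (rule sum_list_le)
  also have "map p (map (\<lambda>x. x - b) xs) = map f xs"
    using b by simp
  finally show "p (sum_list xs) \<le> sum_list (map f xs)" .
next
  note G = is_GG_D[OF GG]
  interpret valued p by (rule G(1))
  fix a ys assume ys: "a \<in> A" "set ys \<subseteq> A" "Suc (length ys) = N"
  have "card (set (a # ys)) \<le> N"
    using card_length[of "a # ys"] ys by (simp del: set_simps)
  then have "trivial_in p (set (a # ys)) f"
    using ys by (intro small) auto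
  then obtain b where b: "\<And>x. x \<in> set (a # ys) \<Longrightarrow> f x = p (x - b)"
    unfolding trivial_in_def by blast
  \<comment> \<open>\<open>N - 1\<close> copies of \<open>b\<close> sum to \<open>- b\<close>, so
    subtracting \<open>b\<close> from every letter of \<open>ys\<close> adds one \<open>b\<close> to
    the sum.\<close>
  have "gmul (length ys) b + b = 0"
    using G(7)[of b] N ys(3) by (metis gmul_Suc not_numeral_le_zero)
  then have "sum_list ys + b = sum_list (map (\<lambda>x. x - b) ys)"
    by (simp add: sum_list_diff_const eq_diff_eq add.assoc) (simp add: add.commute)
  also have "p \<dots> \<le> sum_list (map p (map (\<lambda>x. x - b) ys))"
    by (rule sum_list_le)
  also have "map p (map (\<lambda>x. x - b) ys) = map f ys"
    using b by simp
  finally show "f a \<le> p (a + sum_list ys) + sum_list (map f ys)"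
    using diff_le[of "a - b" "a + sum_list ys"] minus[of "b + sum_list ys"] b[of a]
    by (simp add: add.commute[of _ b])
qed

text \<open>As \<open>- b = b\<close>, sums of two points are differences, and the word inequalities
  become the Katetov inequalities.\<close>

lemma is_GG_exponent_2_trivial:
  assumes GG: "is_GG r 2 p" and A: "finite A" and f: "f \<in> E_r r p A"
  shows "trivial_in p A f"
proof -
  interpret valued p by (rule is_GG_D(1)[OF GG])
  have neg: "a + b = a - b" for a b :: 'a
    using is_GG_D(7)[OF GG, of b] by (simp add: eval_nat_numeral eq_diff_eq add.assoc)
  show ?thesis
  proof (rule is_GG_katetov_trivial[OF GG _ A f])
    fix xs assume xs: "set xs \<subseteq> A" "length xs = 2"
    then obtain a b where "xs = [a, b]"
      by (auto simp: length_Suc_conv numeral_2_eq_2)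
    moreover have "p (a + b) \<le> f a + f b" if "a \<in> A" "b \<in> A"
      using E_rD(5)[OF f that] by (subst neg)
    ultimately show "p (sum_list xs) \<le> sum_list (map f xs)"
      using xs by simp
  next
    fix a ys assume ys: "a \<in> A" "set ys \<subseteq> A" "Suc (length ys) = 2"
    then obtain b where "ys = [b]"
      by (auto simp: length_Suc_conv numeral_2_eq_2)
    moreover have "f a \<le> p (a + b) + f b" if "b \<in> A"
      using E_rD(4)[OF f ys(1) that] by (subst neg) simp
    ultimately show "f a \<le> p (a + sum_list ys) + sum_list (map f ys)"
      using ys by simp
  qed simp
qed

section \<open>From approximate to exact realisation, and the case of exponent zero\<close>

lemma (in valued) trivial_if_zero:
  assumes f: "f \<in> E_r r p A" and a: "a \<in> A" "f a = 0"
  shows "trivial_in p A f"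
  unfolding trivial_in_def
proof (intro exI ballI)
  fix x assume x: "x \<in> A"
  show "f x = p (x - a)"
    using E_rD(2)[OF f x] E_rD(4,5)[OF f x a(1)] a(2) by simp
qed

text \<open>Each approximant \<open>b\<close> is adjoined to \<open>A\<close> with a small
  prescribed distance, and the next approximant is taken for this larger set. So consecutive
  approximants are close, and their limit is an exact solution.\<close>

lemma (in valued) trivial_if_approx:
  assumes complete: "vg_complete p" and r: "\<And>x. ereal (p x) \<le> r"
    and approx: "\<And>A f \<epsilon>. finite A \<Longrightarrow> f \<in> E_r r p A \<Longrightarrow> 0 < \<epsilon> \<Longrightarrow> \<exists>b. \<forall>a\<in>A. \<bar>p (a - b) - f a\<bar> \<le> \<epsilon>"
    and A: "finite A" and f: "f \<in> E_r r p A"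
  shows "trivial_in p A f"
proof (cases "A = {}")
  case False
  define P where "P n b \<longleftrightarrow> (\<forall>a\<in>A. \<bar>p (a - b) - f a\<bar> \<le> (1 / 2) ^ n)" for n :: nat and b
  have "\<exists>u. \<forall>n. P n (u n) \<and> p (u (Suc n) - u n) \<le> 2 * (1 / 2) ^ n"
  proof (rule dependent_nat_choice)
    show "\<exists>b. P 0 b"
      using approx[OF A f, of 1] by (simp add: P_def)
  next
    fix b n assume b: "P n b"
    obtain g where g: "g \<in> E_r r p (insert b A)" "g b \<le> (1 / 2) ^ n" "\<And>a. a \<in> A \<Longrightarrow> g a = f a"
    proof (cases "b \<in> A")
      \<comment> \<open>Here \<open>f\<close> itself serves: the approximation at the point
        \<open>b\<close> says that \<open>f b\<close> is already small.\<close>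
      case True
      then show ?thesis
        using that[of f] f b E_rD(2)[OF f True] by (auto simp: P_def insert_absorb)
    next
      case nA: False
      \<comment> \<open>The maximal error is the least admissible distance to \<open>b\<close>.
        Being attained at some \<open>a0\<close>, it also satisfies the upper bounds
        \<open>e \<le> f a + p (a - b)\<close> and \<open>e \<le> r\<close>.\<close>
      define e where "e = Max ((\<lambda>a. \<bar>p (a - b) - f a\<bar>) ` A)"
      have e: "\<bar>p (a - b) - f a\<bar> \<le> e" if "a \<in> A" for a
        unfolding e_def using A that by (intro Max_ge) auto
      have "e \<in> (\<lambda>a. \<bar>p (a - b) - f a\<bar>) ` A"
        unfolding e_def using A False by (intro Max_in) auto
      then obtain a0 where a0: "a0 \<in> A" "e = \<bar>p (a0 - b) - f a0\<bar>"
        by blast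
      have "\<bar>f a - e\<bar> \<le> p (a - b)" if a: "a \<in> A" for a
        using e[OF a] a0 E_rD(4,5)[OF f a a0(1)] triangle[of a0 b a] triangle[of a a0 b] triangle[of a b a0]
          diff_commute[of a a0] diff_commute[of a0 b] E_rD(2)[OF f a] by linarith
      moreover have "ereal e \<le> r"
      proof -
        have "e \<le> p (a0 - b) \<or> e \<le> f a0"
          using E_rD(2)[OF f a0(1)] nonneg[of "a0 - b"] a0(2) by linarith
        then show ?thesis
          using r[of "a0 - b"] E_rD(3)[OF f a0(1)] by (metis ereal_less_eq(3) order_trans)
      qed
      moreover have "p (a - b) \<le> f a + e" if a: "a \<in> A" for a
        using e[OF a] by linarith
      moreover have "0 \<le> e"
        using a0(2) by simp
      ultimately have "f(b := e) \<in> E_r r p (insert b A)"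
        using nA f diff_commute by (auto simp: E_r_def katetov_on_def abs_minus_commute add.commute)
      moreover have "e \<le> (1 / 2) ^ n"
        using b a0 by (simp add: P_def)
      ultimately show ?thesis
        using nA by (intro that[of "f(b := e)"]) auto
    qed
    obtain b' where b': "\<And>a. a \<in> insert b A \<Longrightarrow> \<bar>p (a - b') - g a\<bar> \<le> (1 / 2) ^ Suc n"
      using approx[OF _ g(1), of "(1 / 2) ^ Suc n"] A by auto
    have "P (Suc n) b'"
      using b' g(3) by (fastforce simp: P_def)
    moreover have "p (b' - b) \<le> 2 * (1 / 2) ^ n"
    proof -
      have "\<bar>p (b' - b) - g b\<bar> \<le> (1 / 2) ^ Suc n"
        using b'[of b] diff_commute[of b b'] by simp
      also have "(1 / 2) ^ Suc n \<le> (1 / 2 :: real) ^ n"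
        by simp
      finally show ?thesis
        using g(2) by linarith
    qed
    ultimately show "\<exists>b'. P (Suc n) b' \<and> p (b' - b) \<le> 2 * (1 / 2) ^ n"
      by blast
  qed
  then obtain u where u: "\<And>n. P n (u n)" "\<And>n. p (u (Suc n) - u n) \<le> 2 * (1 / 2) ^ n"
    by blast
  obtain l where l: "(\<lambda>n. p (u n - l)) \<longlonglongrightarrow> 0"
    using geometric_limit[OF complete u(2)] by blast
  have "f a = p (a - l)" if a: "a \<in> A" for a
  proof -
    have "(\<lambda>n. p (a - u n)) \<longlonglongrightarrow> f a"
    proof (rule LIM_zero_cancel, rule Lim_null_comparison)
      show "\<forall>\<^sub>F n in sequentially. norm (p (a - u n) - f a) \<le> (1 / 2) ^ n"
        using u(1) a by (auto simp: P_def)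
      show "(\<lambda>n. (1 / 2) ^ n :: real) \<longlonglongrightarrow> 0"
        by (rule LIMSEQ_realpow_zero) auto
    qed
    then show ?thesis
      using diff_tendsto[OF l, of a] LIMSEQ_unique by blast
  qed
  then show ?thesis
    by (auto simp: trivial_in_def)
qed simp

text \<open>For \<open>N = 0\<close> the order of the new generator is free. As \<open>f\<close> is
  bounded below by some \<open>c > 0\<close>, long words cost at least \<open>D\<close>, which
  bounds \<open>p\<close> on \<open>K\<close> and \<open>f\<close> on \<open>A\<close>; so a large
  order makes both word inequalities hold.\<close>

lemma is_GG_0_approx_torsion:
  assumes GG: "is_GG r 0 p" and A: "finite A" "\<And>a. a \<in> A \<Longrightarrow> \<exists>n>0. gmul n a = 0"
    and f: "f \<in> E_r r p A" and pos: "\<And>a. a \<in> A \<Longrightarrow> 0 < f a" and \<epsilon>: "0 < \<epsilon>"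
  shows "\<exists>b. \<forall>a\<in>A. \<bar>p (a - b) - f a\<bar> \<le> \<epsilon>"
proof (cases "A = {}")
  case False
  note G = is_GG_D[OF GG]
  interpret valued p by (rule G(1))
  obtain K where K: "A \<subseteq> K" "finite K" "add_subgroup K"
    using finite_subgroup_exists[OF A] by blast
  define c where "c = Min (f ` A)"
  have c: "0 < c" "\<And>a. a \<in> A \<Longrightarrow> c \<le> f a"
    using A(1) False pos by (auto simp: c_def)
  define D where "D = Max (p ` K \<union> f ` A)"
  have D: "\<And>x. x \<in> K \<Longrightarrow> p x \<le> D" "\<And>a. a \<in> A \<Longrightarrow> f a \<le> D"
    unfolding D_def using A(1) K(2) by (auto intro!: Max_ge)
  obtain k :: nat where k: "D \<le> real k * c"
    using c(1) reals_Archimedean3 less_imp_le by metis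
  have F: "D \<le> sum_list (map f xs)" if "set xs \<subseteq> A" "k \<le> length xs" for xs
  proof -
    have "D \<le> real (length xs) * c"
      using k c(1) that(2) by (meson less_imp_le mult_right_mono of_nat_le_iff order_trans)
    also have "\<dots> \<le> sum_list (map f xs)"
      using that(1) c(2) by (intro sum_list_lower) auto
    finally show ?thesis .
  qed
  \<comment> \<open>The order \<open>k + 2\<close> is at least 2 and leaves at least
    \<open>k\<close> letters in both kinds of words.\<close>
  have "\<exists>q. extends r (k + 2) q \<and> (\<forall>a\<in>A. q (a, -1) = f a)"
  proof (rule katetov_extends[OF E_rD(1)[OF f] _ _ _ G(5) E_rD(3)[OF f] False])
    fix xs assume xs: "set xs \<subseteq> A" "length xs = k + 2"
    have "p (sum_list xs) \<le> D"
      using xs K(1) add_subgroup_sum_list[OF K(3), of xs] by (intro D) auto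
    also have "\<dots> \<le> sum_list (map f xs)"
      using xs by (intro F) auto
    finally show "p (sum_list xs) \<le> sum_list (map f xs)" .
  next
    fix a ys assume "a \<in> A" "set ys \<subseteq> A" "Suc (length ys) = k + 2"
    then show "f a \<le> p (a + sum_list ys) + sum_list (map f ys)"
      using D(2)[of a] F[of ys] by (simp add: add_increasing)
  qed simp
  then obtain q where q: "extends r (k + 2) q" "\<And>a. a \<in> A \<Longrightarrow> q (a, -1) = f a"
    by blast
  obtain \<beta> where \<beta>: "\<forall>x\<in>K. \<forall>m. \<bar>p (x + \<beta> m) - q (x, m)\<bar> \<le> \<epsilon>"
    using extends_approx[OF G(4) _ _ _ q(1) K(2,3) \<epsilon>] by auto
  show ?thesis
  proof (intro exI[of _ "- \<beta> (-1)"] ballI)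
    fix a assume "a \<in> A"
    then show "\<bar>p (a - - \<beta> (-1)) - f a\<bar> \<le> \<epsilon>"
      using bspec[OF \<beta>, of a, rule_format, of "-1"] q(2) K(1) by auto
  qed
qed simp

text \<open>The witness is the largest 1-Lipschitz extension, the minimum of
  \<open>f a + p (x - a)\<close> over \<open>a \<in> A\<close>, truncated at
  \<open>r\<close>.\<close>

lemma (in valued) E_r_extend:
  assumes A: "finite A" "A \<noteq> {}" and f: "f \<in> E_r r p A" and r: "\<And>x. ereal (p x) \<le> r"
  shows "\<exists>g\<in>E_r r p UNIV. \<forall>a\<in>A. g a = f a"
proof -
  have r0: "0 \<le> r"
    using r[of 0] by (simp add: zero_ereal_def)
  define h where "h x = Min ((\<lambda>a. f a + p (x - a)) ` A)" for x
  have h_le: "h x \<le> f a + p (x - a)" if "a \<in> A" for x a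
    unfolding h_def using A that by (intro Min_le) auto
  have h_ex: "\<exists>a\<in>A. h x = f a + p (x - a)" for x
    using Min_in[of "(\<lambda>a. f a + p (x - a)) ` A"] A unfolding h_def
    by (metis (no_types, lifting) finite_imageI imageE image_is_empty)
  have h_nonneg: "0 \<le> h x" for x
    using h_ex[of x] E_rD(2)[OF f] by (auto intro!: add_nonneg_nonneg)
  have h1: "h x \<le> h y + p (x - y)" for x y
  proof -
    obtain a where "a \<in> A" "h y = f a + p (y - a)"
      using h_ex by blast
    then show ?thesis
      using h_le[of a x] triangle[of x a y] by simp
  qed
  have h2: "p (x - y) \<le> h x + h y" for x y
  proof -
    obtain a b where ab: "a \<in> A" "b \<in> A" "h x = f a + p (x - a)" "h y = f b + p (y - b)"
      using h_ex by blast
    then show ?thesis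
      using E_rD(5)[OF f ab(1,2)] triangle[of x y a] triangle[of a y b] diff_commute[of y b] by linarith
  qed
  have h_eq: "h a = f a" if a: "a \<in> A" for a
  proof -
    obtain b where b: "b \<in> A" "h a = f b + p (a - b)"
      using h_ex by blast
    then show ?thesis
      using h_le[OF a, of a] E_rD(4)[OF f a b(1)] by simp
  qed
  show ?thesis
  proof (intro bexI[of _ "\<lambda>x. cap r (h x)"] ballI)
    show "cap r (h a) = f a" if "a \<in> A" for a
      using cap_eq[OF r0] E_rD(3)[OF f that] h_eq[OF that] by simp
    have "\<bar>cap r (h x) - cap r (h y)\<bar> \<le> p (x - y)" for x y
      using h1[of x y] h1[of y x] diff_commute[of x y] by (auto simp: cap_def)
    \<comment> \<open>Truncation does not change \<open>p (x - y)\<close>, which is at most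
      \<open>r\<close>; so subadditivity of \<open>cap\<close> applies.\<close>
    moreover have "p (x - y) \<le> cap r (h x) + cap r (h y)" for x y
      using cap_mono[OF r0 h2[of x y]] cap_eq[OF r0 r] cap_add[OF r0 h_nonneg h_nonneg, of x y]
      by (metis order_trans)
    ultimately show "(\<lambda>x. cap r (h x)) \<in> E_r r p UNIV"
      using cap_nonneg[OF r0 h_nonneg] cap_le_bound[OF r0] by (auto simp: E_r_def katetov_on_def)
  qed
qed

text \<open>Elements of finite order are dense, so the points of \<open>A\<close> are moved slightly
  to such elements, with values taken from an extension of \<open>f\<close> to the whole group. Maps
  with a zero are treated apart because the torsion case asks for positive values.\<close>

lemma is_GG_0_trivial:
  assumes GG: "is_GG r 0 p" and A: "finite A" and f: "f \<in> E_r r p A"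
  shows "trivial_in p A f"
proof -
  note G = is_GG_D[OF GG]
  interpret valued p by (rule G(1))
  have "\<exists>b. \<forall>a\<in>A. \<bar>p (a - b) - f a\<bar> \<le> \<epsilon>" if A: "finite A" and f: "f \<in> E_r r p A" and \<epsilon>: "0 < \<epsilon>" for A f \<epsilon>
  proof (cases "A = {} \<or> (\<exists>a\<in>A. f a = 0)")
    case True
    then have "trivial_in p A f"
      using trivial_if_zero[OF f] by auto
    then obtain b where "\<forall>a\<in>A. f a = p (a - b)"
      by (auto simp: trivial_in_def)
    then show ?thesis
      using \<epsilon> by (intro exI[of _ b]) auto
  next
    case False
    then have pos: "0 < f a" if "a \<in> A" for a
      using E_rD(2)[OF f] that by (auto simp: order_less_le)
    have A0: "A \<noteq> {}"
      using False by blast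
    obtain g where g: "g \<in> E_r r p UNIV" "\<And>a. a \<in> A \<Longrightarrow> g a = f a"
      using E_r_extend[OF A A0 f G(5)] by blast
    \<comment> \<open>The extension is 1-Lipschitz, so \<open>\<delta> \<le> f a\<close> keeps it
      positive at the moved points.\<close>
    define \<delta> where "\<delta> = min (\<epsilon> / 3) (Min (f ` A))"
    have \<delta>: "0 < \<delta>" "\<delta> \<le> \<epsilon> / 3" "\<And>a. a \<in> A \<Longrightarrow> \<delta> \<le> f a"
      using \<epsilon> A A0 pos by (auto simp: \<delta>_def min.coboundedI2)
    have "\<forall>x. \<exists>y. (\<exists>n>0. gmul n y = 0) \<and> p (x - y) < \<delta>"
      using GG \<delta>(1) by (simp add: is_GG_def)
    then obtain t where t: "\<And>x. \<exists>n>0. gmul n (t x) = 0" "\<And>x. p (x - t x) < \<delta>"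
      by metis
    have gt: "\<bar>g (t a) - f a\<bar> < \<delta>" if "a \<in> A" for a
      using E_rD(4)[OF g(1), of a "t a"] t(2)[of a] g(2)[OF that] by simp
    have "\<exists>b. \<forall>a\<in>t ` A. \<bar>p (a - b) - g a\<bar> \<le> \<epsilon> / 3"
    proof (rule is_GG_0_approx_torsion[OF GG])
      show "0 < g a" if "a \<in> t ` A" for a
        using that gt \<delta>(3) by force
    qed (use A t(1) E_r_mono[OF g(1)] \<epsilon> in auto)
    then obtain b where b: "\<And>a. a \<in> A \<Longrightarrow> \<bar>p (t a - b) - g (t a)\<bar> \<le> \<epsilon> / 3"
      by blast
    show ?thesis
    proof (intro exI[of _ b] ballI)
      fix a assume a: "a \<in> A"
      have "\<bar>p (a - b) - p (t a - b)\<bar> \<le> p (a - t a)"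
        using abs_diff[of "a - b" "t a - b"] by simp
      then show "\<bar>p (a - b) - f a\<bar> \<le> \<epsilon>"
        using b[OF a] gt[OF a] t(2)[of a] \<delta>(2) by linarith
    qed
  qed
  then show ?thesis
    using trivial_if_approx[OF G(2,5)] A f by blast
qed

section \<open>A nontrivial Katetov map that is trivial on proper subsets\<close>

text \<open>The Lee weight: the distance from \<open>k\<close> to the nearest multiple of
  \<open>N\<close>.\<close>

definition lee :: "nat \<Rightarrow> int \<Rightarrow> int" where
  "lee N k = min (k mod int N) (- k mod int N)"

context
  fixes N :: nat
  assumes N: "N > 1"
begin

lemma lee_nonneg: "0 \<le> lee N k"
  using N by (simp add: lee_def)

lemma lee_minus: "lee N (- k) = lee N k"
  by (simp add: lee_def min.commute)

lemma lee_cong: "int N dvd k - l \<Longrightarrow> lee N k = lee N l"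
  unfolding lee_def by (metis mod_eq_dvd_iff mod_minus_cong)

lemma lee_le_abs: "lee N k \<le> \<bar>k\<bar>"
  using zmod_le_nonneg_dividend[of k "int N"] zmod_le_nonneg_dividend[of "- k" "int N"]
  by (cases "0 \<le> k") (auto simp: lee_def min_le_iff_disj)

lemma lee_le: "lee N k \<le> int N"
  unfolding lee_def by (rule order.trans[OF min.cobounded1]) (use N in \<open>simp add: less_imp_le\<close>)

text \<open>The residue of least absolute value; it reduces subadditivity of the Lee weight to that
  of the absolute value.\<close>

lemma lee_representative: "\<exists>k'. int N dvd k - k' \<and> lee N k = \<bar>k'\<bar>"
proof (cases "k mod int N \<le> - k mod int N")
  case True
  then show ?thesis
    using N by (intro exI[of _ "k mod int N"]) (simp add: lee_def flip: mod_eq_dvd_iff)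
next
  case False
  have "int N dvd - k - (- k mod int N)"
    by (simp flip: mod_eq_dvd_iff)
  then have "int N dvd k - - (- k mod int N)"
    by (metis dvd_minus_iff minus_diff_eq minus_diff_commute add_uminus_conv_diff minus_add_distrib)
  then show ?thesis
    using N False by (intro exI[of _ "- (- k mod int N)"]) (simp add: lee_def)
qed

lemma lee_add: "lee N (k + l) \<le> lee N k + lee N l"
proof -
  obtain k' l' where *: "int N dvd k - k'" "lee N k = \<bar>k'\<bar>" "int N dvd l - l'" "lee N l = \<bar>l'\<bar>"
    using lee_representative by metis
  have "int N dvd (k + l) - (k' + l')"
    using dvd_add[OF *(1,3)] by (simp add: algebra_simps)
  then show ?thesis
    using lee_cong lee_le_abs[of "k' + l'"] * by fastforce
qed

lemma lee_eq_0_iff: "lee N k = 0 \<longleftrightarrow> int N dvd k"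
proof
  assume "lee N k = 0"
  then have "k mod int N = 0 \<or> - k mod int N = 0"
    by (auto simp: lee_def min_def split: if_splits)
  then show "int N dvd k"
    by (auto simp: mod_eq_0_iff_dvd)
next
  assume "int N dvd k"
  then show "lee N k = 0"
    using lee_cong[of k 0] by (simp add: lee_def)
qed

lemma not_dvd_1: "\<not> int N dvd 1" "\<not> int N dvd - 1"
  using N by auto

lemma lee_1: "lee N 1 = 1"
  using lee_le_abs[of 1] lee_nonneg[of 1] lee_eq_0_iff[of 1] not_dvd_1 by linarith

text \<open>On the group of integer vectors whose coordinate sum is divisible by \<open>N\<close>, the Lee weight of the
  all-one vector modulo \<open>N\<close> can be raised by one without violating the triangle inequality,
  because this vector is not a sum of two other vectors of total weight \<open>N\<close> in this group.\<close>

definition all_pm_one :: "(nat \<Rightarrow> int) \<Rightarrow> bool" where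
  "all_pm_one v \<longleftrightarrow> (\<forall>i<N. int N dvd v i - 1) \<or> (\<forall>i<N. int N dvd v i + 1)"

definition lee_weight :: "(nat \<Rightarrow> int) \<Rightarrow> int" where
  "lee_weight v = (\<Sum>i<N. lee N (v i))"

definition raised_weight :: "(nat \<Rightarrow> int) \<Rightarrow> int" where
  "raised_weight v = lee_weight v + of_bool (all_pm_one v)"

definition zero_sums :: "(nat \<Rightarrow> int) set" where
  "zero_sums = {v. int N dvd (\<Sum>i<N. v i)}"

lemma lee_weight_all_pm_one: "all_pm_one v \<Longrightarrow> lee_weight v = int N"
proof -
  assume "all_pm_one v"
  then have "lee N (v i) = 1" if "i < N" for i
    using lee_cong[of "v i" 1] lee_cong[of "v i" "- 1"] lee_minus[of 1] lee_1 that
    by (auto simp: all_pm_one_def)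
  then show ?thesis
    by (simp add: lee_weight_def)
qed

text \<open>Every coordinate contributes at least 1, because \<open>x i\<close> and
  \<open>y i\<close> cannot both vanish modulo \<open>N\<close>. Either some coordinate contributes
  2, or \<open>x\<close> is modulo \<open>N\<close> the indicator of a set \<open>J\<close>; then
  the zero sum forces \<open>card J\<close> to be 0 or \<open>N\<close>, so that \<open>y\<close> or
  \<open>x\<close> is all one.\<close>

lemma lee_weight_sum_all_one:
  assumes x: "x \<in> zero_sums" and xy: "\<And>i. i < N \<Longrightarrow> int N dvd x i + y i - 1"
  shows "int N + 1 \<le> lee_weight x + lee_weight y \<or> all_pm_one x \<or> all_pm_one y"
proof -
  have w: "lee_weight x + lee_weight y = (\<Sum>i<N. lee N (x i) + lee N (y i))"
    by (simp add: lee_weight_def sum.distrib)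
  have y0: "int N dvd x i - 1" if "i < N" "int N dvd y i" for i
    using dvd_diff[OF xy[OF that(1)] that(2)] by (simp add: algebra_simps)
  have y1: "int N dvd y i - 1" if "i < N" "int N dvd x i" for i
    using dvd_diff[OF xy[OF that(1)] that(2)] by (simp add: algebra_simps)
  have pos: "1 \<le> lee N k" if "\<not> int N dvd k" for k
    using lee_eq_0_iff[of k] lee_nonneg[of k] that by linarith
  have ge1: "1 \<le> lee N (x i) + lee N (y i)" if "i < N" for i
  proof (cases "int N dvd x i")
    case True
    then have "\<not> int N dvd y i"
      using y0[OF that] not_dvd_1(1) dvd_diff[of "int N" "x i" "x i - 1"] by auto
    then show ?thesis
      using pos lee_nonneg[of "x i"] by force
  next
    case False
    then show ?thesis
      using pos[OF False] lee_nonneg[of "y i"] by simp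
  qed
  show ?thesis
  proof (cases "\<exists>j<N. \<not> int N dvd x j \<and> \<not> int N dvd x j - 1")
    case True
    then obtain j where j: "j < N" "\<not> int N dvd x j" "\<not> int N dvd x j - 1"
      by blast
    \<comment> \<open>If \<open>y j\<close> vanished modulo \<open>N\<close>, then
      \<open>x j\<close> would be congruent to 1.\<close>
    then have "2 \<le> lee N (x j) + lee N (y j)"
      using pos[of "x j"] pos[of "y j"] y0[OF j(1)] by fastforce
    moreover have "(\<Sum>i\<in>{..<N} - {j}. 1) \<le> (\<Sum>i\<in>{..<N} - {j}. lee N (x i) + lee N (y i))"
      by (rule sum_mono) (use ge1 in auto)
    moreover have "(\<Sum>i<N. lee N (x i) + lee N (y i)) =
        lee N (x j) + lee N (y j) + (\<Sum>i\<in>{..<N} - {j}. lee N (x i) + lee N (y i))"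
      using j(1) by (intro sum.remove) auto
    ultimately show ?thesis
      using w N j(1) by (simp add: of_nat_diff)
  next
    case False
    define J where "J = {i. i < N \<and> int N dvd x i - 1}"
    have J: "J \<subseteq> {..<N}" "finite J"
      by (auto simp: J_def)
    have "int N dvd (\<Sum>i<N. x i - of_bool (i \<in> J))"
      by (rule dvd_sum) (use False in \<open>auto simp: J_def\<close>)
    also have "(\<Sum>i<N. x i - of_bool (i \<in> J)) = (\<Sum>i<N. x i) - (\<Sum>i<N. of_bool (i \<in> J))"
      by (simp add: sum_subtractf)
    also have "(\<Sum>i<N. of_bool (i \<in> J) :: int) = int (card J)"
      using J(1) by (simp add: Int_absorb1)
    finally have "int N dvd int (card J)"
      using x dvd_diff[of "int N" "\<Sum>i<N. x i"] by (fastforce simp: zero_sums_def)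
    then have "N dvd card J"
      by simp
    moreover have "card J \<le> N"
      using card_mono[OF _ J(1)] by simp
    ultimately consider "card J = 0" | "card J = N"
      by (metis dvd_imp_le le_antisym neq0_conv)
    then show ?thesis
    proof cases
      case 1
      then have "all_pm_one y"
        using False J(2) y1 unfolding all_pm_one_def J_def by auto
      then show ?thesis by simp
    next
      case 2
      then have "J = {..<N}"
        using card_subset_eq[OF _ J(1)] by simp
      then have "all_pm_one x"
        unfolding all_pm_one_def J_def by blast
      then show ?thesis by simp
    qed
  qed
qed

lemma all_pm_one_minus: "all_pm_one (- v) \<longleftrightarrow> all_pm_one v"
proof -
  have "- k - 1 = - (k + 1)" "- k + 1 = - (k - 1)" for k :: int
    by simp_all
  then have "int N dvd - k - 1 \<longleftrightarrow> int N dvd k + 1" "int N dvd - k + 1 \<longleftrightarrow> int N dvd k - 1" for k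
    by (simp_all only: dvd_minus_iff)
  then show ?thesis
    by (auto simp: all_pm_one_def)
qed

lemma lee_weight_minus: "lee_weight (- v) = lee_weight v"
  by (simp add: lee_weight_def lee_minus)

lemma lee_weight_nonneg: "0 \<le> lee_weight v"
  by (simp add: lee_weight_def lee_nonneg sum_nonneg)

lemma lee_weight_add: "lee_weight (x + y) \<le> lee_weight x + lee_weight y"
  unfolding lee_weight_def sum.distrib[symmetric] by (rule sum_mono) (simp add: lee_add)

lemma add_subgroup_zero_sums: "add_subgroup zero_sums"
  by (auto simp: add_subgroup_def zero_sums_def sum.distrib sum_negf)

lemma raised_weight_eq_0: "(\<And>i. i < N \<Longrightarrow> int N dvd v i) \<Longrightarrow> raised_weight v = 0"
proof -
  assume v: "\<And>i. i < N \<Longrightarrow> int N dvd v i"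
  then have "\<not> all_pm_one v"
    using N not_dvd_1(1) unfolding all_pm_one_def
    by (metis One_nat_def dvd_add_right_iff dvd_diff_right_iff less_trans zero_less_one)
  moreover have "lee_weight v = 0"
    unfolding lee_weight_def by (rule sum.neutral) (use v lee_eq_0_iff in auto)
  ultimately show ?thesis
    by (simp add: raised_weight_def)
qed

text \<open>The increment on the left matters only if \<open>x + y\<close> is all one or all minus
  one modulo \<open>N\<close>, and negation reduces the second case to the first. Then the
  right-hand side is at least \<open>N + 1\<close> by \<open>lee_weight_sum_all_one\<close>.\<close>

lemma raised_weight_add:
  assumes x: "x \<in> zero_sums" and y: "y \<in> zero_sums"
  shows "raised_weight (x + y) \<le> raised_weight x + raised_weight y"
proof (cases "all_pm_one (x + y)")
  case True
  have "int N + 1 \<le> lee_weight x + lee_weight y \<or> all_pm_one x \<or> all_pm_one y"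
  proof (cases "\<forall>i<N. int N dvd (x + y) i - 1")
    case True
    then show ?thesis
      using lee_weight_sum_all_one[OF x] by simp
  next
    case False
    then have *: "int N dvd x i + y i + 1" if "i < N" for i
      using True that by (auto simp: all_pm_one_def)
    have "int N dvd (- x) i + (- y) i - 1" if "i < N" for i
    proof -
      have "(- x) i + (- y) i - 1 = - (x i + y i + 1)"
        by simp
      then show ?thesis
        using *[OF that] by (simp only: dvd_minus_iff)
    qed
    then show ?thesis
      using lee_weight_sum_all_one[of "- x" "- y"] add_subgroupD(3)[OF add_subgroup_zero_sums x]
      by (simp add: all_pm_one_minus lee_weight_minus)
  qed
  then show ?thesis
    using lee_weight_all_pm_one[OF True] lee_weight_all_pm_one[of x] lee_weight_all_pm_one[of y] True
      lee_weight_nonneg[of x] lee_weight_nonneg[of y]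
    by (auto simp: raised_weight_def)
next
  case False
  then show ?thesis
    using lee_weight_add[of x y] by (simp add: raised_weight_def)
qed

lemma pvalue_on_raised_weight:
  assumes "0 \<le> c"
  shows "pvalue_on zero_sums (\<lambda>v. c * real_of_int (raised_weight v))"
proof -
  have "c * real_of_int (raised_weight (x + y)) \<le> c * real_of_int (raised_weight x) + c * real_of_int (raised_weight y)"
    if "x \<in> zero_sums" "y \<in> zero_sums" for x y
  proof -
    have "real_of_int (raised_weight (x + y)) \<le> real_of_int (raised_weight x) + real_of_int (raised_weight y)"
      using raised_weight_add[OF that] by linarith
    then show ?thesis
      using mult_left_mono[OF _ assms] by (metis distrib_left)
  qed
  then show ?thesis
    using assms raised_weight_eq_0[of 0] lee_weight_nonneg
    by (auto simp: pvalue_on_def raised_weight_def lee_weight_minus all_pm_one_minus)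
qed

lemma raised_weight_le: "raised_weight v \<le> int N * int N + 1"
proof -
  have "lee_weight v \<le> (\<Sum>i<N. int N)"
    unfolding lee_weight_def by (rule sum_mono) (rule lee_le)
  then show ?thesis
    by (simp add: raised_weight_def)
qed

lemma raised_weight_finite_quotient:
  "\<exists>T. finite T \<and> T \<subseteq> zero_sums \<and> (\<forall>v\<in>zero_sums. \<exists>t\<in>T. raised_weight (v - t) = 0)"
proof -
  \<comment> \<open>The weights see only the coordinates below \<open>N\<close>, so representatives
    may vanish elsewhere.\<close>
  let ?F = "{t :: nat \<Rightarrow> int. \<forall>i. (i \<in> {..<N} \<longrightarrow> t i \<in> {0..<int N}) \<and> (i \<notin> {..<N} \<longrightarrow> t i = 0)}"
  have "\<exists>t\<in>?F \<inter> zero_sums. raised_weight (v - t) = 0" if v: "v \<in> zero_sums" for v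
  proof -
    let ?t = "\<lambda>i. if i < N then v i mod int N else 0"
    have dvd: "int N dvd v i - ?t i" if "i < N" for i
      using that by (simp flip: mod_eq_dvd_iff)
    then have "int N dvd (\<Sum>i<N. v i - ?t i)"
      by (intro dvd_sum) auto
    then have "int N dvd (\<Sum>i<N. ?t i)"
      using v dvd_diff[of "int N" "\<Sum>i<N. v i" "\<Sum>i<N. v i - ?t i"]
      by (simp add: zero_sums_def sum_subtractf)
    moreover have "raised_weight (v - ?t) = 0"
      by (rule raised_weight_eq_0) (use dvd in simp)
    moreover have "?t \<in> ?F"
      using N by auto
    ultimately show ?thesis
      by (intro bexI[of _ ?t]) (auto simp: zero_sums_def)
  qed
  moreover have "finite ?F"
    by (rule finite_set_of_finite_funs) auto
  ultimately show ?thesis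
    by (intro exI[of _ "?F \<inter> zero_sums"]) auto
qed

text \<open>Unit vectors are not in \<open>zero_sums\<close>; subtracting the one at 0 puts them
  there without changing their mutual differences. \<open>diff_unit 0\<close> is the zero
  vector.\<close>

definition diff_unit :: "nat \<Rightarrow> nat \<Rightarrow> int" where
  "diff_unit i k = of_bool (k = i) - of_bool (k = 0)"

lemma diff_unit_zero_sums: "i < N \<Longrightarrow> diff_unit i \<in> zero_sums"
  using N by (simp add: zero_sums_def diff_unit_def sum_subtractf of_bool_def)

lemma sum_list_diff_unit:
  "sum_list (map diff_unit xs) k = int (count_list xs k) - of_bool (k = 0) * int (length xs)"
  by (induction xs) (auto simp: diff_unit_def algebra_simps)

text \<open>Modulo \<open>N\<close> the sum is the vector of multiplicities, since coordinate 0 is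
  lowered by exactly \<open>N\<close>. The missing index \<open>j\<close> leaves a zero coordinate,
  so the increment does not occur.\<close>

lemma raised_weight_sum_list_diff_unit:
  assumes xs: "set xs \<subseteq> {..<N}" "length xs = N" and j: "j < N" "j \<notin> set xs"
  shows "raised_weight (sum_list (map diff_unit xs)) \<le> int N"
proof -
  let ?v = "sum_list (map diff_unit xs)"
  have v: "int N dvd ?v k - int (count_list xs k)" for k
    using xs(2) by (simp add: sum_list_diff_unit)
  have "lee N (?v k) \<le> int (count_list xs k)" for k
    using lee_cong[OF v] lee_le_abs[of "int (count_list xs k)"] by simp
  then have "lee_weight ?v \<le> (\<Sum>k<N. int (count_list xs k))"
    unfolding lee_weight_def by (intro sum_mono) auto
  also have "\<dots> = int N"
    using sum_count_set[OF xs(1)] xs(2) by (simp flip: of_nat_sum)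
  finally have "lee_weight ?v \<le> int N" .
  moreover have "\<not> all_pm_one ?v"
  proof -
    have "int N dvd ?v j"
      using v[of j] j(2) by (simp add: count_list_0_iff)
    then show ?thesis
      using not_dvd_1 j(1) unfolding all_pm_one_def
      by (metis dvd_add_right_iff dvd_diff_right_iff)
  qed
  ultimately show ?thesis
    by (simp add: raised_weight_def)
qed

text \<open>With \<open>N > 2\<close> some coordinate outside \<open>{i, j}\<close> is 0, which
  excludes the increment; for \<open>N = 2\<close> the difference of the two vectors would be all
  one modulo 2.\<close>

lemma raised_weight_diff_unit:
  assumes N2: "N > 2" and ij: "i < N" "j < N"
  shows "raised_weight (diff_unit i - diff_unit j) \<le> 2"
proof -
  let ?v = "diff_unit i - diff_unit j"
  have v: "?v k = of_bool (k = i) - of_bool (k = j)" for k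
    by (simp add: diff_unit_def)
  have "lee N (?v k) \<le> of_bool (k = i) + of_bool (k = j)" for k
    using lee_le_abs[of "?v k"] unfolding v by (auto split: if_splits)
  then have "lee_weight ?v \<le> (\<Sum>k<N. of_bool (k = i) + of_bool (k = j))"
    unfolding lee_weight_def by (intro sum_mono) auto
  also have "\<dots> = 2"
    using ij by (simp add: sum.distrib of_bool_def)
  finally have "lee_weight ?v \<le> 2" .
  moreover have "\<not> all_pm_one ?v"
  proof -
    have "\<not> {..<N} \<subseteq> {i, j}"
      using N2 card_mono[of "{i, j}" "{..<N}"] card_insert_le_m1[of 2 "{j}" i] by fastforce
    then obtain k where "k < N" "k \<noteq> i" "k \<noteq> j"
      by auto
    then have "k < N" "?v k = 0"
      by (simp_all add: diff_unit_def)
    then show ?thesis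
      using not_dvd_1 unfolding all_pm_one_def by fastforce
  qed
  ultimately show ?thesis
    by (simp add: raised_weight_def)
qed

lemma raised_weight_diff_unit_pos:
  assumes ij: "i < N" "j < N" "i \<noteq> j"
  shows "0 < raised_weight (diff_unit i - diff_unit j)"
proof -
  have "1 = lee N ((diff_unit i - diff_unit j) i)"
    using ij(3) lee_1 by (simp add: diff_unit_def)
  also have "\<dots> \<le> lee_weight (diff_unit i - diff_unit j)"
    unfolding lee_weight_def by (rule member_le_sum) (use ij lee_nonneg in auto)
  finally show ?thesis
    by (simp add: raised_weight_def)
qed

lemma raised_weight_sum_diff_unit: "raised_weight (sum_list (map diff_unit [0..<N])) = int N + 1"
proof -
  let ?v = "sum_list (map diff_unit [0..<N])"
  have "?v k = 1 - of_bool (k = 0) * int N" if "k < N" for k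
    using that by (simp add: sum_list_diff_unit count_list_eq_length_filter distinct_length_filter)
  then have "all_pm_one ?v"
    by (simp add: all_pm_one_def)
  then show ?thesis
    using lee_weight_all_pm_one by (simp add: raised_weight_def)
qed

lemma gmul_fun: "gmul n v i = int n * (v i :: int)"
  by (induction n) (auto simp: algebra_simps)

text \<open>(G2) with the zero subgroup realises a multiple of \<open>raised_weight\<close> up to a
  factor \<open>1 \<plusminus> \<epsilon>\<close>. The points are the images of the
  \<open>diff_unit i\<close>: the increment makes the sum of all \<open>N\<close> of them too large
  for the constant map, while words that miss an index do not see it.\<close>

lemma is_GG_nontrivial_constant:
  fixes p :: "'a::ab_group_add \<Rightarrow> real"
  assumes GG: "is_GG r N p" and N2: "N > 2" and r: "1 \<le> r"
  shows "\<exists>A \<kappa>. finite A \<and> card A = N \<and> 0 < \<kappa> \<and> (\<lambda>_. \<kappa>) \<in> E_r r p A \<and> \<not> trivial_in p A (\<lambda>_. \<kappa>) \<and>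
    (\<forall>B. B \<subset> A \<longrightarrow> trivial_in p B (\<lambda>_. \<kappa>)) \<and> (\<exists>z. 2 * \<kappa> \<le> p z)"
proof -
  note G = is_GG_D[OF GG]
  interpret valued p by (rule G(1))
  \<comment> \<open>\<open>c\<close> scales all values to at most 1, by
    \<open>raised_weight_le\<close>; \<open>\<kappa>\<close> absorbs the upper error factor; and
    \<open>\<epsilon>\<close> is so small that \<open>(1 - \<epsilon>) * c * (N + 1)\<close>, the
    lower bound for the full sum, still exceeds \<open>N * \<kappa>\<close>.\<close>
  define c where "c = 1 / (real N * real N + 1)"
  define \<epsilon> where "\<epsilon> = 1 / (2 * real N + 2)"
  define \<kappa> where "\<kappa> = c * (1 + \<epsilon>)"
  define B where "B = real N * real N + 1"
  have "1 * 1 \<le> real N * real N"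
    using N2 by (intro mult_mono) auto
  then have B: "2 \<le> B"
    by (simp add: B_def)
  have c_eq: "c = 1 / B"
    by (simp add: c_def B_def)
  have c: "0 < c" "c \<le> 1 / 2"
    using B frac_le[of 1 1 2 B] by (auto simp: c_eq)
  have \<epsilon>: "0 < \<epsilon>" "\<epsilon> < 1" "\<epsilon> * (2 * real N + 1) < 1"
    using N2 by (auto simp: \<epsilon>_def field_simps)
  have \<kappa>: "0 < \<kappa>" "\<kappa> \<le> 1"
    using c \<epsilon> mult_mono[of c "1 / 2" "1 + \<epsilon>" 2] by (auto simp: \<kappa>_def)
  obtain T where T: "finite T" "T \<subseteq> zero_sums" "\<And>v. v \<in> zero_sums \<Longrightarrow> \<exists>t\<in>T. raised_weight (v - t) = 0"
    using raised_weight_finite_quotient by blast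
  have "\<exists>\<psi>. (\<forall>x\<in>zero_sums. \<forall>y\<in>zero_sums. \<psi> (x + y) = \<psi> x + \<psi> y) \<and> (\<forall>x\<in>{0}. p (0 - \<psi> x) \<le> \<epsilon>) \<and>
    (\<forall>x\<in>zero_sums. (1 - \<epsilon>) * (c * real_of_int (raised_weight x)) \<le> p (\<psi> x) \<and>
      p (\<psi> x) \<le> (1 + \<epsilon>) * (c * real_of_int (raised_weight x)))"
  proof (rule prop_G2_pseudo[where \<phi> = "\<lambda>_. 0" and \<Delta> = "{0}" and T = T,
        OF G(4) add_subgroup_zero_sums pvalue_on_raised_weight T(1,2)])
    show "\<exists>t\<in>T. c * real_of_int (raised_weight (v - t)) = 0" if "v \<in> zero_sums" for v
      using T(3)[OF that] by auto
    show "c * real_of_int (raised_weight (gmul N v)) = 0" for v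
    proof -
      have "raised_weight (gmul N v) = 0"
        by (rule raised_weight_eq_0) (simp add: gmul_fun)
      then show ?thesis
        by simp
    qed
    show "ereal (c * real_of_int (raised_weight v)) \<le> r" for v
    proof -
      have "real_of_int (raised_weight v) \<le> real_of_int (int N * int N + 1)"
        by (simp only: of_int_le_iff raised_weight_le)
      then have "c * real_of_int (raised_weight v) \<le> 1"
        using B by (simp add: c_eq flip: B_def)
      then have "ereal (c * real_of_int (raised_weight v)) \<le> 1"
        by (simp add: one_ereal_def)
      then show ?thesis
        using r by (rule order_trans)
    qed
    show "p 0 = c * real_of_int (raised_weight x)" if "x \<in> {0}" for x
    proof -
      have "raised_weight x = 0"
        by (rule raised_weight_eq_0) (use that in simp)
      then show ?thesis
        by simp
    qed
    show "add_subgroup {0 :: nat \<Rightarrow> int}"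
      by (simp add: add_subgroup_def)
    show "{0} \<subseteq> zero_sums"
      using add_subgroupD(1)[OF add_subgroup_zero_sums] by simp
    show "0 \<le> c" "0 < \<epsilon>" "\<epsilon> < 1"
      using c(1) \<epsilon>(1,2) by simp_all
  qed simp_all
  then obtain \<psi> where \<psi>: "\<And>x y. x \<in> zero_sums \<Longrightarrow> y \<in> zero_sums \<Longrightarrow> \<psi> (x + y) = \<psi> x + \<psi> y"
    "\<And>x. x \<in> zero_sums \<Longrightarrow> (1 - \<epsilon>) * (c * real_of_int (raised_weight x)) \<le> p (\<psi> x)"
    "\<And>x. x \<in> zero_sums \<Longrightarrow> p (\<psi> x) \<le> (1 + \<epsilon>) * (c * real_of_int (raised_weight x))"
    by blast
  have \<psi>_le: "p (\<psi> x) \<le> \<kappa> * real_of_int (raised_weight x)" if "x \<in> zero_sums" for x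
    using \<psi>(3)[OF that] by (simp add: \<kappa>_def mult_ac)
  note S = add_subgroupD[OF add_subgroup_zero_sums]
  have \<psi>0: "\<psi> 0 = 0"
    using \<psi>(1)[of 0 0] S(1) by simp
  have \<psi>_diff: "\<psi> (x - y) = \<psi> x - \<psi> y" if "x \<in> zero_sums" "y \<in> zero_sums" for x y
    using \<psi>(1)[of "x - y" y] S(4) that by simp
  have \<psi>_sum: "sum_list (map diff_unit xs) \<in> zero_sums \<and>
    \<psi> (sum_list (map diff_unit xs)) = sum_list (map (\<lambda>i. \<psi> (diff_unit i)) xs)" if "set xs \<subseteq> {..<N}" for xs
    using that by (induction xs) (auto simp: \<psi>0 S \<psi>(1) diff_unit_zero_sums)
  let ?a = "\<lambda>i. \<psi> (diff_unit i)"
  let ?A = "?a ` {..<N}"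
  have inj: "inj_on ?a {..<N}"
  proof (rule inj_onI, rule ccontr)
    fix i j assume ij: "i \<in> {..<N}" "j \<in> {..<N}" "?a i = ?a j" "i \<noteq> j"
    have "0 < (1 - \<epsilon>) * (c * real_of_int (raised_weight (diff_unit i - diff_unit j)))"
      using raised_weight_diff_unit_pos[of i j] ij c \<epsilon> by simp
    also have "\<dots> \<le> p (\<psi> (diff_unit i - diff_unit j))"
      using \<psi>(2) S(4) diff_unit_zero_sums ij by simp
    also have "\<dots> = 0"
      using \<psi>_diff diff_unit_zero_sums ij by simp
    finally show False by simp
  qed
  have close: "p (?a i - ?a j) \<le> 2 * \<kappa>" if "i < N" "j < N" for i j
  proof -
    have "p (?a i - ?a j) \<le> \<kappa> * real_of_int (raised_weight (diff_unit i - diff_unit j))"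
      using \<psi>_le[of "diff_unit i - diff_unit j"] \<psi>_diff diff_unit_zero_sums S(4) that by simp
    also have "\<dots> \<le> \<kappa> * 2"
      using raised_weight_diff_unit[OF N2 that] \<kappa> by (intro mult_left_mono) auto
    finally show ?thesis by simp
  qed
  define z where "z = sum_list (map ?a [0..<N])"
  have z: "real N * \<kappa> < p z"
  proof -
    have "real N * \<kappa> < (1 - \<epsilon>) * (c * (real N + 1))"
      using \<epsilon>(3) c(1) mult_strict_left_mono[OF \<epsilon>(3) c(1)] by (simp add: \<kappa>_def algebra_simps)
    also have "\<dots> \<le> p z"
      using \<psi>(2)[of "sum_list (map diff_unit [0..<N])"] \<psi>_sum[of "[0..<N]"]
      by (simp add: z_def raised_weight_sum_diff_unit atLeast0LessThan)
    finally show ?thesis .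
  qed
  have E: "(\<lambda>_. \<kappa>) \<in> E_r r p ?A"
  proof -
    have "ereal \<kappa> \<le> 1"
      using \<kappa>(2) by (simp add: one_ereal_def)
    then have "ereal \<kappa> \<le> r"
      using r by (rule order_trans)
    then show ?thesis
      using close \<kappa> by (auto simp: E_r_def katetov_on_def)
  qed
  show ?thesis
  proof (intro exI conjI allI impI)
    show "finite ?A" "card ?A = N"
      using card_image[OF inj] by auto
    show "0 < \<kappa>" "(\<lambda>_. \<kappa>) \<in> E_r r p ?A"
      by (fact \<kappa> E)+
    show "\<not> trivial_in p ?A (\<lambda>_. \<kappa>)"
    proof
      assume "trivial_in p ?A (\<lambda>_. \<kappa>)"
      then obtain b where b: "\<And>i. i < N \<Longrightarrow> \<kappa> = p (?a i - b)"
        unfolding trivial_in_def by auto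
      \<comment> \<open>A realising \<open>b\<close> would satisfy \<open>N b = 0\<close>, so
        \<open>z\<close> would be a sum of \<open>N\<close> elements of value
        \<open>\<kappa>\<close>.\<close>
      have "z = sum_list (map (\<lambda>x. x - b) (map ?a [0..<N]))"
        using G(7)[of b] N by (simp add: z_def sum_list_diff_const del: map_map)
      also have "p \<dots> \<le> sum_list (map p (map (\<lambda>x. x - b) (map ?a [0..<N])))"
        by (rule sum_list_le)
      also have "map p (map (\<lambda>x. x - b) (map ?a [0..<N])) = map (\<lambda>_. \<kappa>) [0..<N]"
        using b by simp
      also have "sum_list \<dots> = real N * \<kappa>"
        by (simp add: sum_list_triv)
      finally show False
        using z by simp
    qed
    \<comment> \<open>The element \<open>z\<close> shows that the diameter is at least
      \<open>2 * \<kappa>\<close>, as the comparison with Urysohn spaces requires.\<close>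
    have "2 * \<kappa> \<le> real N * \<kappa>"
      using \<kappa>(1) N2 by (intro mult_right_mono) auto
    then show "2 * \<kappa> \<le> p z"
      using z by simp
    fix B assume B: "B \<subset> ?A"
    show "trivial_in p B (\<lambda>_. \<kappa>)"
    proof (rule is_GG_katetov_trivial[OF GG])
      show "2 \<le> N" "finite B" "(\<lambda>_. \<kappa>) \<in> E_r r p B"
        using N B E_r_mono[OF E] by (auto intro: finite_subset[of B ?A])
      fix xs assume xs: "set xs \<subseteq> B" "length xs = N"
      obtain j where j: "j < N" "?a j \<notin> B"
        using B by auto
      \<comment> \<open>A word in \<open>B\<close> is rewritten as a word in indices that misses
        \<open>j\<close>.\<close>
      have "\<forall>x\<in>set xs. \<exists>i<N. x = ?a i"
        using xs B by auto
      then obtain \<iota> where \<iota>: "\<And>x. x \<in> set xs \<Longrightarrow> \<iota> x < N \<and> x = ?a (\<iota> x)"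
        by metis
      have map: "map ?a (map \<iota> xs) = xs"
        using \<iota> by (simp add: map_idI)
      have sub: "set (map \<iota> xs) \<subseteq> {..<N}" "j \<notin> set (map \<iota> xs)"
        using \<iota> j xs by auto
      have "p (sum_list xs) \<le> \<kappa> * real_of_int (raised_weight (sum_list (map diff_unit (map \<iota> xs))))"
        using \<psi>_le[of "sum_list (map diff_unit (map \<iota> xs))"] \<psi>_sum[OF sub(1)] map by simp
      also have "\<dots> \<le> \<kappa> * real N"
        using raised_weight_sum_list_diff_unit[OF sub(1) _ j(1) sub(2)] xs(2) \<kappa>(1)
        by (intro mult_left_mono) auto
      also have "\<dots> = sum_list (map (\<lambda>_. \<kappa>) xs)"
        using xs(2) by (simp add: sum_list_triv)
      finally show "p (sum_list xs) \<le> sum_list (map (\<lambda>_. \<kappa>) xs)" .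
    next
      fix a :: 'a and ys :: "'a list" assume "Suc (length ys) = N"
      then have "1 * \<kappa> \<le> real (length ys) * \<kappa>"
        using N2 \<kappa>(1) by (intro mult_right_mono) auto
      then show "\<kappa> \<le> p (a + sum_list ys) + sum_list (map (\<lambda>_. \<kappa>) ys)"
        by (simp add: sum_list_triv add_increasing)
    qed
  qed
qed

end

section \<open>Back and forth\<close>

text \<open>A relation rather than a map, so that the backward step is the forward step for the
  converse.\<close>

definition partial_isometry ::
    "('a::ab_group_add \<Rightarrow> real) \<Rightarrow> ('b::ab_group_add \<Rightarrow> real) \<Rightarrow> ('a \<times> 'b) set \<Rightarrow> bool" where
  "partial_isometry p q R \<longleftrightarrow> (\<forall>x y x' y'. (x, y) \<in> R \<longrightarrow> (x', y') \<in> R \<longrightarrow> p (x - x') = q (y - y'))"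

lemma partial_isometryD:
  "partial_isometry p q R \<Longrightarrow> (x, y) \<in> R \<Longrightarrow> (x', y') \<in> R \<Longrightarrow> p (x - x') = q (y - y')"
  unfolding partial_isometry_def by blast

lemma partial_isometry_converse: "partial_isometry q p (R\<inverse>) \<longleftrightarrow> partial_isometry p q R"
  unfolding partial_isometry_def converse_iff by metis

text \<open>The distances from \<open>x\<close> to the domain of \<open>R\<close>, carried over to
  its range, form a Katetov map; a point realising it is the partner of \<open>x\<close>.\<close>

lemma partial_isometry_insert:
  assumes p: "valued p" and q: "valued q" and r: "\<And>x. ereal (p x) \<le> r"
    and inj: "\<And>A f. finite A \<Longrightarrow> f \<in> E_r r q A \<Longrightarrow> trivial_in q A f"
    and R: "finite R" "partial_isometry p q R"
  shows "\<exists>y. partial_isometry p q (insert (x, y) R)"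
proof -
  interpret p: valued p by (rule p)
  interpret q: valued q by (rule q)
  have "\<forall>y\<in>snd ` R. \<exists>x'. (x', y) \<in> R"
    by auto
  then obtain g where g: "\<And>y. y \<in> snd ` R \<Longrightarrow> (g y, y) \<in> R"
    by metis
  define f where "f y = p (g y - x)" for y
  have eq: "p (g a - g b) = q (a - b)" if "a \<in> snd ` R" "b \<in> snd ` R" for a b
    using partial_isometryD[OF R(2)] g that by blast
  have "f \<in> E_r r q (snd ` R)"
    unfolding E_r_def katetov_on_def mem_Collect_eq
  proof (intro conjI ballI)
    fix a b assume ab: "a \<in> snd ` R" "b \<in> snd ` R"
    show "\<bar>f a - f b\<bar> \<le> q (a - b)"
      using p.abs_diff[of "g a - x" "g b - x"] eq[OF ab] by (simp add: f_def)
    show "q (a - b) \<le> f a + f b"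
      using p.triangle[of "g a" "g b" x] p.diff_commute[of x "g b"] eq[OF ab] by (simp add: f_def)
  qed (simp_all add: f_def r)
  then obtain y where y: "\<And>b. b \<in> snd ` R \<Longrightarrow> f b = q (b - y)"
    using inj[of "snd ` R" f] R(1) by (auto simp: trivial_in_def)
  have new: "p (x' - x) = q (y' - y)" if xy: "(x', y') \<in> R" for x' y'
  proof -
    have y': "y' \<in> snd ` R"
      using xy by force
    then have "p (x' - g y') = q (y' - y')"
      using partial_isometryD[OF R(2) xy] g by blast
    then have "x' = g y'"
      by simp
    then show ?thesis
      using y[OF y'] by (simp add: f_def)
  qed
  have "p (x - x') = q (y - y')" if "(x', y') \<in> R" for x' y'
    using new[OF that] p.diff_commute[of x x'] q.diff_commute[of y y'] by simp
  then have "partial_isometry p q (insert (x, y) R)"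
    unfolding partial_isometry_def using new partial_isometryD[OF R(2)] by auto
  then show ?thesis ..
qed

text \<open>The partners of a sequence in the domain converging to \<open>x\<close> form a Cauchy
  sequence, whose limit is \<open>y\<close>.\<close>

lemma partial_isometry_extend_to_point:
  assumes p: "valued p" and q: "valued q" "vg_complete q" and R: "partial_isometry p q R"
    and dense: "\<And>x e. 0 < e \<Longrightarrow> \<exists>(a, b)\<in>R. p (x - a) < e"
  shows "\<exists>y. \<forall>(a, b)\<in>R. q (b - y) = p (a - x)"
proof -
  interpret p: valued p by (rule p)
  interpret q: valued q by (rule q)
  have "\<exists>s. s \<in> R \<and> p (x - fst s) < (1 / 2) ^ n" for n :: nat
    using dense[of "(1 / 2) ^ n" x] by fastforce
  then obtain s where s: "\<And>n::nat. s n \<in> R" "\<And>n. p (x - fst (s n)) < (1 / 2) ^ n"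
    by metis
  have eq: "p (a - fst (s n)) = q (b - snd (s n))" if "(a, b) \<in> R" for a b n
    using partial_isometryD[OF R that, of "fst (s n)" "snd (s n)"] s(1) by simp
  have "q (snd (s (Suc n)) - snd (s n)) \<le> 2 * (1 / 2) ^ n" for n
  proof -
    have "q (snd (s (Suc n)) - snd (s n)) = p (fst (s (Suc n)) - fst (s n))"
      using eq[of "fst (s (Suc n))" "snd (s (Suc n))"] s(1) by simp
    also have "\<dots> \<le> (1 / 2) ^ Suc n + (1 / 2) ^ n"
      using p.triangle[of "fst (s (Suc n))" "fst (s n)" x] p.diff_commute[of x "fst (s (Suc n))"]
        s(2)[of n] s(2)[of "Suc n"] by linarith
    also have "\<dots> \<le> 2 * (1 / 2) ^ n"
      by simp
    finally show ?thesis .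
  qed
  from q.geometric_limit[OF q(2) this] obtain y where y: "(\<lambda>n. q (snd (s n) - y)) \<longlonglongrightarrow> 0"
    by blast
  have x: "(\<lambda>n. p (fst (s n) - x)) \<longlonglongrightarrow> 0"
  proof (rule Lim_null_comparison)
    show "\<forall>\<^sub>F n in sequentially. norm (p (fst (s n) - x)) \<le> (1 / 2) ^ n"
      using s(2) p.diff_commute[of x] by (auto intro!: always_eventually less_imp_le)
    show "(\<lambda>n. (1 / 2) ^ n :: real) \<longlonglongrightarrow> 0"
      by (rule LIMSEQ_realpow_zero) auto
  qed
  have "q (b - y) = p (a - x)" if "(a, b) \<in> R" for a b
    using p.diff_tendsto[OF x, of a] q.diff_tendsto[OF y, of b] eq[OF that] LIMSEQ_unique by simp
  then show ?thesis
    by blast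
qed

text \<open>Extension to points defines the map everywhere; applied to the converse relation, it
  provides preimages.\<close>

lemma isometric_if_partial_isometry_dense:
  assumes p: "valued p" "vg_complete p" and q: "valued q" "vg_complete q" and R: "partial_isometry p q R"
    and dense_p: "\<And>x e. 0 < e \<Longrightarrow> \<exists>(a, b)\<in>R. p (x - a) < e"
    and dense_q: "\<And>y e. 0 < e \<Longrightarrow> \<exists>(a, b)\<in>R. q (y - b) < e"
  shows "isometric_vg p q"
proof -
  interpret p: valued p by (rule p)
  interpret q: valued q by (rule q)
  have "\<forall>x. \<exists>y. \<forall>(a, b)\<in>R. q (b - y) = p (a - x)"
    using partial_isometry_extend_to_point[OF p(1) q R dense_p] by blast
  from choice[OF this] obtain g where g: "\<And>x a b. (a, b) \<in> R \<Longrightarrow> q (b - g x) = p (a - x)"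
    by blast
  have iso: "q (g x - g x') = p (x - x')" for x x'
  proof -
    have close: "\<bar>q (g x - g x') - p (x - x')\<bar> \<le> e" if e: "0 < e" for e
    proof -
      obtain a b where ab: "(a, b) \<in> R" "p (x' - a) < e / 2"
        using dense_p[of "e / 2" x'] e by auto
      have "\<bar>q (g x - g x') - q (g x - b)\<bar> \<le> q (b - g x')"
        using q.abs_diff[of "g x - g x'" "g x - b"] by simp
      moreover have "\<bar>p (x - x') - p (x - a)\<bar> \<le> p (a - x')"
        using p.abs_diff[of "x - x'" "x - a"] by simp
      ultimately show ?thesis
        using g[OF ab(1), of x] g[OF ab(1), of x'] ab(2) q.diff_commute[of b "g x"]
          p.diff_commute[of a x] p.diff_commute[of a x'] by linarith
    qed
    have "\<bar>q (g x - g x') - p (x - x')\<bar> \<le> 0"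
      by (rule field_le_epsilon) (use close in simp)
    then show ?thesis
      by simp
  qed
  have "inj g"
  proof (rule injI)
    fix x x' assume "g x = g x'"
    then show "x = x'"
      using iso[of x x'] by simp
  qed
  moreover have "y \<in> range g" for y
  proof -
    have "\<exists>x. \<forall>(b, a)\<in>R\<inverse>. p (a - x) = q (b - y)"
    proof (rule partial_isometry_extend_to_point[OF q(1) p])
      show "\<exists>(b, a)\<in>R\<inverse>. q (y - b) < e" if "0 < e" for y e
        using dense_q[OF that, of y] by auto
    qed (use R partial_isometry_converse in blast)
    then obtain x where x: "\<And>a b. (a, b) \<in> R \<Longrightarrow> p (a - x) = q (b - y)"
      by blast
    \<comment> \<open>\<open>g x\<close> and \<open>y\<close> have the same distance to every
      partner \<open>b\<close>, and this distance can be made arbitrarily small.\<close>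
    have "q (g x - y) \<le> 0 + e" if e: "0 < e" for e
    proof -
      obtain a b where ab: "(a, b) \<in> R" "p (x - a) < e / 2"
        using dense_p[of "e / 2" x] e by auto
      then show ?thesis
        using g[OF ab(1), of x] x[OF ab(1)] q.triangle[of "g x" y b] q.diff_commute[of b "g x"]
          p.diff_commute[of a x] by linarith
    qed
    then have "q (g x - y) \<le> 0"
      by (rule field_le_epsilon)
    then have "q (g x - y) = 0"
      using q.nonneg[of "g x - y"] by linarith
    then show ?thesis
      by auto
  qed
  ultimately have "bij g"
    by (auto simp: bij_def)
  then show ?thesis
    using iso by (auto simp: isometric_vg_def)
qed

lemma vg_separable_sequence:
  assumes "vg_separable p"
  shows "\<exists>c :: nat \<Rightarrow> _. \<forall>x. \<forall>e>0. \<exists>n. p (x - c n) < e"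
proof -
  obtain D where D: "countable D" "\<And>x e. 0 < e \<Longrightarrow> \<exists>y\<in>D. p (x - y) < e"
    using assms by (auto simp: vg_separable_def)
  have "D \<noteq> {}"
    using D(2)[of 1] by auto
  then have "range (from_nat_into D) = D"
    using D(1) by (rule range_from_nat_into)
  then have "\<exists>n. p (x - from_nat_into D n) < e" if "0 < e" for x e
    using D(2)[OF that, of x] by (metis rangeE)
  then show ?thesis
    by (intro exI[of _ "from_nat_into D"]) simp
qed

text \<open>Back and forth along dense sequences \<open>c\<close> and \<open>d\<close>: stage
  \<open>n\<close> puts \<open>c n\<close> into the domain and \<open>d n\<close> into the
  range.\<close>

lemma isometric_if_katetov_trivial:
  fixes p :: "'a::ab_group_add \<Rightarrow> real" and q :: "'b::ab_group_add \<Rightarrow> real"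
  assumes p: "valued p" "vg_complete p" "vg_separable p" "\<And>x. ereal (p x) \<le> r"
    and q: "valued q" "vg_complete q" "vg_separable q" "\<And>x. ereal (q x) \<le> r"
    and triv_p: "\<And>A f. finite A \<Longrightarrow> f \<in> E_r r p A \<Longrightarrow> trivial_in p A f"
    and triv_q: "\<And>A f. finite A \<Longrightarrow> f \<in> E_r r q A \<Longrightarrow> trivial_in q A f"
  shows "isometric_vg p q"
proof -
  from vg_separable_sequence[OF p(3)] obtain c where c: "\<And>x e. 0 < e \<Longrightarrow> \<exists>n::nat. p (x - c n) < e"
    by blast
  from vg_separable_sequence[OF q(3)] obtain d where d: "\<And>x e. 0 < e \<Longrightarrow> \<exists>n::nat. q (x - d n) < e"
    by blast
  have "\<exists>R. \<forall>n. (finite (R n) \<and> partial_isometry p q (R n)) \<and>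
    R n \<subseteq> R (Suc n) \<and> c n \<in> fst ` R (Suc n) \<and> d n \<in> snd ` R (Suc n)"
  proof (rule dependent_nat_choice)
    show "\<exists>R. finite R \<and> partial_isometry p q R"
      by (rule exI[of _ "{}"]) (simp add: partial_isometry_def)
  next
    fix R :: "('a \<times> 'b) set" and n assume R: "finite R \<and> partial_isometry p q R"
    have "\<exists>y. partial_isometry p q (insert (c n, y) R)"
      by (rule partial_isometry_insert[OF p(1) q(1) p(4)]) (use R triv_q in auto)
    then obtain y where y: "partial_isometry p q (insert (c n, y) R)" ..
    let ?S = "(insert (c n, y) R)\<inverse>"
    have S: "finite ?S" "partial_isometry q p ?S"
      using R y by (simp_all add: partial_isometry_converse)
    have "\<exists>x. partial_isometry q p (insert (d n, x) ?S)"
      by (rule partial_isometry_insert[OF q(1) p(1) q(4)]) (use S triv_p in auto)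
    then obtain x where "partial_isometry q p (insert (d n, x) ?S)" ..
    moreover have "insert (d n, x) ?S = (insert (x, d n) (insert (c n, y) R))\<inverse>"
      by auto
    ultimately have "partial_isometry q p ((insert (x, d n) (insert (c n, y) R))\<inverse>)"
      by (simp only:)
    then have "partial_isometry p q (insert (x, d n) (insert (c n, y) R))"
      by (simp only: partial_isometry_converse)
    then show "\<exists>R'. (finite R' \<and> partial_isometry p q R') \<and> R \<subseteq> R' \<and> c n \<in> fst ` R' \<and> d n \<in> snd ` R'"
      using R by (intro exI[of _ "insert (x, d n) (insert (c n, y) R)"]) auto
  qed
  then obtain R where step: "\<forall>n. (finite (R n) \<and> partial_isometry p q (R n)) \<and>
    R n \<subseteq> R (Suc n) \<and> c n \<in> fst ` R (Suc n) \<and> d n \<in> snd ` R (Suc n)"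
    by (elim exE) (rule that)
  then have R: "\<And>n. partial_isometry p q (R n)" "\<And>n. R n \<subseteq> R (Suc n)"
    "\<And>n. c n \<in> fst ` R (Suc n)" "\<And>n. d n \<in> snd ` R (Suc n)"
    by simp_all
  have mono: "R m \<subseteq> R n" if "m \<le> n" for m n
    using R(2) that by (rule lift_Suc_mono_le)
  show ?thesis
  proof (rule isometric_if_partial_isometry_dense[OF p(1,2) q(1,2), of "\<Union>n. R n"])
    have "p (x - x') = q (y - y')" if "(x, y) \<in> R m" "(x', y') \<in> R n" for x y x' y' m n
      using partial_isometryD[OF R(1)[of "max m n"]] mono[of m "max m n"] mono[of n "max m n"] that
      by (meson max.cobounded1 max.cobounded2 subsetD)
    then show "partial_isometry p q (\<Union>n. R n)"
      unfolding partial_isometry_def by blast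
    show "\<exists>(a, b)\<in>\<Union>n. R n. p (x - a) < e" if "0 < e" for x e
    proof -
      from c[OF that] obtain n where "p (x - c n) < e"
        by blast
      moreover obtain b where "(c n, b) \<in> R (Suc n)"
        using R(3)[of n] by auto
      ultimately show ?thesis
        by blast
    qed
    show "\<exists>(a, b)\<in>\<Union>n. R n. q (y - b) < e" if "0 < e" for y e
    proof -
      from d[OF that] obtain n where "q (y - d n) < e"
        by blast
      moreover obtain a where "(a, d n) \<in> R (Suc n)"
        using R(4)[of n] by auto
      ultimately show ?thesis
        by blast
    qed
  qed
qed

section \<open>Isometry invariants\<close>

lemma isometric_vg_sym:
  assumes "isometric_vg p q"
  shows "isometric_vg q p"
proof -
  obtain g where g: "bij g" "\<And>x y. q (g x - g y) = p (x - y)"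
    using assms by (auto simp: isometric_vg_def)
  have "p (inv_into UNIV g x - inv_into UNIV g y) = q (x - y)" for x y
    using g(2)[of "inv_into UNIV g x" "inv_into UNIV g y"] g(1) by (simp add: bij_is_surj surj_f_inv_f)
  then show ?thesis
    using bij_imp_bij_inv[OF g(1)] by (auto simp: isometric_vg_def)
qed

section \<open>The least \<open>k\<close> as an isometry invariant\<close>

lemma k_property_isometric:
  assumes iso: "isometric_vg p q" and k: "k_property r p k"
  shows "k_property r q k"
proof -
  obtain h where h: "bij h" "\<And>x y. p (h x - h y) = q (x - y)"
    using isometric_vg_sym[OF iso] by (auto simp: isometric_vg_def)
  have [simp]: "inv_into UNIV h (h x) = x" for x
    using h(1) by (simp add: bij_is_inj)
  have triv: "trivial_in p (h ` B) (f \<circ> inv_into UNIV h) \<longleftrightarrow> trivial_in q B f" for B f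
  proof
    assume "trivial_in p (h ` B) (f \<circ> inv_into UNIV h)"
    then obtain b where b: "\<forall>a\<in>B. f a = p (h a - b)"
      by (auto simp: trivial_in_def)
    moreover obtain b' where "b = h b'"
      using h(1) by (metis bij_pointE)
    ultimately show "trivial_in q B f"
      by (auto simp: trivial_in_def h(2))
  next
    assume "trivial_in q B f"
    then obtain b where "\<forall>a\<in>B. f a = q (a - b)"
      by (auto simp: trivial_in_def)
    then show "trivial_in p (h ` B) (f \<circ> inv_into UNIV h)"
      unfolding trivial_in_def by (intro exI[of _ "h b"]) (auto simp: h(2))
  qed
  show ?thesis
    unfolding k_property_def
  proof (intro allI impI)
    fix A f assume A: "finite A \<and> A \<noteq> {} \<and> f \<in> E_r r q A"
    then have "finite (h ` A) \<and> h ` A \<noteq> {} \<and> f \<circ> inv_into UNIV h \<in> E_r r p (h ` A)"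
      by (auto simp: E_r_def katetov_on_def h(2))
    then have "trivial_in p (h ` A) (f \<circ> inv_into UNIV h) \<longleftrightarrow>
        (\<forall>B. B \<subseteq> h ` A \<and> B \<noteq> {} \<and> card B \<le> k \<longrightarrow> trivial_in p B (f \<circ> inv_into UNIV h))"
      using k by (simp add: k_property_def)
    also have "\<dots> \<longleftrightarrow> (\<forall>B. B \<subseteq> A \<and> B \<noteq> {} \<and> card B \<le> k \<longrightarrow> trivial_in p (h ` B) (f \<circ> inv_into UNIV h))"
      using card_image[OF inj_on_subset[OF bij_is_inj[OF h(1)] subset_UNIV]]
      by (metis (no_types, lifting) image_is_empty image_mono subset_imageE)
    finally show "trivial_in q A f \<longleftrightarrow>
        (\<forall>B. B \<subseteq> A \<and> B \<noteq> {} \<and> card B \<le> k \<longrightarrow> trivial_in q B f)"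
      by (simp add: triv)
  qed
qed

lemma k_property_if_katetov_trivial:
  assumes "\<And>A f. finite A \<Longrightarrow> f \<in> E_r r p A \<Longrightarrow> trivial_in p A f"
  shows "k_property r p k"
  unfolding k_property_def
proof (intro allI impI iffI)
  fix A f B assume "finite A \<and> A \<noteq> {} \<and> f \<in> E_r r p A" "trivial_in p A f" "B \<subseteq> A \<and> B \<noteq> {} \<and> card B \<le> k"
  then show "trivial_in p B f"
    using trivial_in_mono by blast
qed (use assms in blast)

lemma is_GG_k_property:
  assumes "is_GG r N p" "N \<ge> 2"
  shows "k_property r p N"
  unfolding k_property_def
proof (intro allI impI iffI)
  fix A f B assume "finite A \<and> A \<noteq> {} \<and> f \<in> E_r r p A" "trivial_in p A f" "B \<subseteq> A \<and> B \<noteq> {} \<and> card B \<le> N"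
  then show "trivial_in p B f"
    using trivial_in_mono by blast
next
  fix A f assume A: "finite A \<and> A \<noteq> {} \<and> f \<in> E_r r p A"
    and small: "\<forall>B. B \<subseteq> A \<and> B \<noteq> {} \<and> card B \<le> N \<longrightarrow> trivial_in p B f"
  show "trivial_in p A f"
    by (rule is_GG_trivial_if_small_trivial[OF assms]) (use A small in auto)
qed

text \<open>Subsets of at most \<open>k < N\<close> points of the exceptional set are proper, so the
  property would make the constant map trivial on the whole set.\<close>

lemma is_GG_k_property_lower:
  assumes GG: "is_GG r N p" and N: "N > 2" and r: "1 \<le> r" and k: "k_property r p k"
  shows "N \<le> k"
proof (rule ccontr)
  assume less: "\<not> N \<le> k"
  have "N > 1"
    using N by simp
  from is_GG_nontrivial_constant[OF this GG N r] obtain A \<kappa> where A: "finite A" "card A = N"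
    "(\<lambda>_. \<kappa>) \<in> E_r r p A" "\<not> trivial_in p A (\<lambda>_. \<kappa>)" "\<And>B. B \<subset> A \<Longrightarrow> trivial_in p B (\<lambda>_. \<kappa>)"
    by blast
  have "A \<noteq> {}"
    using A(2) N by auto
  moreover have "trivial_in p B (\<lambda>_. \<kappa>)" if "B \<subseteq> A" "card B \<le> k" for B
    by (rule A(5)) (use A(2) that less in auto)
  ultimately have "trivial_in p A (\<lambda>_. \<kappa>)"
    using k[unfolded k_property_def, rule_format, of A "\<lambda>_. \<kappa>"] A(1,3) by simp
  with A(4) show False
    by blast
qed

lemma is_GG_0_or_2_trivial:
  assumes "is_GG r N p" "N \<in> {0, 2}" "finite A" "f \<in> E_r r p A"
  shows "trivial_in p A f"
  using assms is_GG_0_trivial is_GG_exponent_2_trivial by blast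

text \<open>(G2) with \<open>\<epsilon> = 1 / 2\<close> is applied to a cyclic group whose nonzero
  elements have value 4, which leaves at least 2 for the image of a generator.\<close>

lemma is_GG_unbounded:
  fixes p :: "'a::ab_group_add \<Rightarrow> real"
  assumes GG: "is_GG \<infinity> N p" and N: "N \<noteq> 1"
  shows "\<exists>z. 2 \<le> p z"
proof -
  note G = is_GG_D[OF GG]
  interpret valued p by (rule G(1))
  define M where "M = (if N = 0 then 2 else int N)"
  have M: "M > 1"
    using N by (auto simp: M_def)
  define q where "q m = (if M dvd m then 0 else 4 :: real)" for m
  have q: "pvalue_on UNIV q"
    by (auto simp: pvalue_on_def q_def dvd_add)
  have "\<exists>\<psi>. (\<forall>x\<in>UNIV. \<forall>y\<in>UNIV. \<psi> (x + y) = \<psi> x + \<psi> y) \<and> (\<forall>x\<in>{0}. p (0 - \<psi> x) \<le> 1 / 2) \<and>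
    (\<forall>x\<in>UNIV. (1 - 1 / 2) * q x \<le> p (\<psi> x) \<and> p (\<psi> x) \<le> (1 + 1 / 2) * q x)"
  proof (rule prop_G2_pseudo[where \<phi> = "\<lambda>_. 0" and \<Delta> = "{0}" and T = "{0..<M}", OF G(4) add_subgroup_UNIV q])
    show "\<exists>t\<in>{0..<M}. q (m - t) = 0" for m
      using M by (intro bexI[of _ "m mod M"]) (auto simp: q_def simp flip: mod_eq_dvd_iff)
    have "gmul n m = int n * m" for n m
      by (induction n) (auto simp: algebra_simps)
    then show "q (gmul N m) = 0" if "N \<noteq> 0" for m
      using that by (simp add: q_def M_def)
    show "p 0 = q m" if "m \<in> {0}" for m
      using that by (simp add: q_def)
  qed (simp_all add: add_subgroup_def)
  then obtain \<psi> where "\<And>m. (1 - 1 / 2) * q m \<le> p (\<psi> m)"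
    by blast
  from this[of 1] have "2 \<le> p (\<psi> 1)"
    using M by (simp add: q_def)
  then show ?thesis ..
qed

lemma is_GG_isometric_bound:
  assumes p: "is_GG 1 N p" and q: "is_GG \<infinity> M q" "M \<noteq> 1"
  shows "\<not> isometric_vg p q"
proof
  assume "isometric_vg p q"
  then obtain g where g: "bij g" "\<And>x y. q (g x - g y) = p (x - y)"
    by (auto simp: isometric_vg_def)
  obtain z where z: "2 \<le> q z"
    using is_GG_unbounded[OF q] by blast
  obtain x y where "z = g x" "0 = g y"
    using g(1) by (metis bij_pointE)
  then have "2 \<le> p (x - y)"
    using g(2)[of x y] z by (metis diff_zero)
  moreover have "p (x - y) \<le> 1"
    using is_GG_D(5)[OF p, of "x - y"] by (simp add: one_ereal_def)
  ultimately show False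
    by simp
qed

text \<open>The diameter determines \<open>r\<close>. The least \<open>k\<close> is \<open>N\<close>
  for \<open>N > 2\<close> and 0 for exponents 0 and 2, so it separates all pairs except those two
  exponents, for which back and forth gives an isometry.\<close>

lemma is_GG_isometric_iff:
  assumes p: "is_GG r N p" and q: "is_GG s M q" and rs: "r \<in> {1, \<infinity>}" "s \<in> {1, \<infinity>}"
    and NM: "N \<noteq> 1" "M \<noteq> 1" "(r, N) \<noteq> (s, M)"
  shows "isometric_vg p q \<longleftrightarrow> r = s \<and> {N, M} = {0, 2}"
proof
  assume iso: "isometric_vg p q"
  have rs_eq: "r = s"
  proof (rule ccontr)
    assume "r \<noteq> s"
    then consider "r = 1" "s = \<infinity>" | "r = \<infinity>" "s = 1"
      using rs by auto
    then show False
      using is_GG_isometric_bound[of N p M q] is_GG_isometric_bound[of M q N p] p q NM(1,2) iso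
        isometric_vg_sym[OF iso] by cases simp_all
  qed
  then have q': "is_GG r M q"
    using q by simp
  have r1: "1 \<le> r"
    using rs(1) by auto
  have k: "k_property r p k \<longleftrightarrow> k_property r q k" for k
    using k_property_isometric[OF iso] k_property_isometric[OF isometric_vg_sym[OF iso]] by blast
  have N: "N \<in> {0, 2} \<or> 2 < N" and M: "M \<in> {0, 2} \<or> 2 < M"
    using NM(1,2) by auto
  have "N \<le> M" if "2 < N"
  proof (cases "2 < M")
    case True
    then show ?thesis
      using is_GG_k_property_lower[OF p that r1] is_GG_k_property[OF q'] k by simp
  next
    case False
    \<comment> \<open>Here \<open>k = 0\<close> has the property, so the lower bound gives
      \<open>N \<le> 0\<close>.\<close>
    then have "k_property r q 0"
      using M is_GG_0_or_2_trivial[OF q'] by (intro k_property_if_katetov_trivial) auto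
    then show ?thesis
      using is_GG_k_property_lower[OF p that r1] k by blast
  qed
  moreover have "M \<le> N" if "2 < M"
  proof (cases "2 < N")
    case True
    then show ?thesis
      using is_GG_k_property_lower[OF q' that r1] is_GG_k_property[OF p] k by simp
  next
    case False
    then have "k_property r p 0"
      using N is_GG_0_or_2_trivial[OF p] by (intro k_property_if_katetov_trivial) auto
    then show ?thesis
      using is_GG_k_property_lower[OF q' that r1] k by blast
  qed
  ultimately have "N \<in> {0, 2}" "M \<in> {0, 2}"
    using N M rs_eq NM(3) by auto
  then show "r = s \<and> {N, M} = {0, 2}"
    using rs_eq NM(3) by auto
next
  assume "r = s \<and> {N, M} = {0, 2}"
  then have "r = s" "N \<in> {0, 2}" "M \<in> {0, 2}"
    by blast+
  then show "isometric_vg p q"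
    using is_GG_D(1-3,5)[OF p] is_GG_D(1-3,5)[OF q] is_GG_0_or_2_trivial[OF p] is_GG_0_or_2_trivial[OF q]
    by (intro isometric_if_katetov_trivial[where r = r]) auto
qed

text \<open>A point at distance \<open>\<kappa>\<close> from all of \<open>A\<close> is adjoined
  abstractly, the finite space is embedded, and an isometry of the group moves the copy of
  \<open>A\<close> back onto \<open>A\<close>; the extra point then realises the constant map. The
  element \<open>z\<close> makes the diameter large enough.\<close>

lemma urysohn_vg_constant_trivial:
  fixes p :: "'a::ab_group_add \<Rightarrow> real"
  assumes p: "valued p" and U: "urysohn_vg p" and A: "finite A" and \<kappa>: "0 < \<kappa>"
    and f: "(\<lambda>_. \<kappa>) \<in> E_r r p A" and z: "2 * \<kappa> \<le> p z"
  shows "trivial_in p A (\<lambda>_. \<kappa>)"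
proof -
  interpret valued p by (rule p)
  have close: "p (a - b) \<le> 2 * \<kappa>" if "a \<in> A" "b \<in> A" for a b
    using E_rD(5)[OF f that] by simp
  \<comment> \<open>\<open>None\<close> stands for the extra point.\<close>
  define Y where "Y = insert None (Some ` A)"
  define \<Delta> where "\<Delta> u v = (case (u, v) of (Some a, Some b) \<Rightarrow> p (a - b) | (None, None) \<Rightarrow> 0 | _ \<Rightarrow> \<kappa>)"
    for u v :: "'a option"
  have Y: "metric_on Y \<Delta>"
    unfolding metric_on_def
  proof
    show "\<forall>x\<in>Y. \<forall>y\<in>Y. 0 \<le> \<Delta> x y \<and> (\<Delta> x y = 0 \<longleftrightarrow> x = y) \<and> \<Delta> x y = \<Delta> y x"
      using \<kappa> diff_commute by (auto simp: Y_def \<Delta>_def)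
    show "\<forall>x\<in>Y. \<forall>y\<in>Y. \<forall>z\<in>Y. \<Delta> x z \<le> \<Delta> x y + \<Delta> y z"
      using \<kappa> close triangle by (auto simp: Y_def \<Delta>_def)
  qed
  have \<Delta>_le: "\<Delta> u v \<le> 2 * \<kappa>" if "u \<in> Y" "v \<in> Y" for u v
    using that \<kappa> close by (auto simp: Y_def \<Delta>_def)
  have finite_Y: "finite Y"
    using A by (simp add: Y_def)
  \<comment> \<open>Spaces in the definition of Urysohn have real numbers as points, so the finite
    space is coded by reals.\<close>
  obtain \<sigma>' :: "'a option \<Rightarrow> nat" where "inj_on \<sigma>' Y"
    using finite_imp_inj_to_nat_seg[OF finite_Y] by blast
  define \<sigma> where "\<sigma> u = real (\<sigma>' u)" for u
  have \<sigma>: "inj_on \<sigma> Y"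
    using \<open>inj_on \<sigma>' Y\<close> by (auto simp: \<sigma>_def inj_on_def)
  define S where "S = \<sigma> ` Y"
  define d where "d s t = \<Delta> (inv_into Y \<sigma> s) (inv_into Y \<sigma> t)" for s t
  have inv_\<sigma>: "inv_into Y \<sigma> (\<sigma> u) = u" if "u \<in> Y" for u
    using \<sigma> that by simp
  have d: "d (\<sigma> u) (\<sigma> v) = \<Delta> u v" if "u \<in> Y" "v \<in> Y" for u v
    using inv_\<sigma> that by (simp add: d_def)
  have metric: "metric_on S d"
    using Y \<sigma> unfolding metric_on_def S_def by (auto simp: d inj_on_eq_iff)
  have "d s s = 0" if "s \<in> S" for s
    using metric that unfolding metric_on_def by blast
  then have "\<exists>t\<in>S. d s t < e" if "s \<in> S" "0 < e" for s e
    using that by (intro bexI[of _ s]) auto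
  moreover have "countable S"
    using finite_Y by (auto simp: S_def intro: countable_finite)
  ultimately have sep: "separable_on S d"
    unfolding separable_on_def by blast
  have "mdiam S d \<le> ereal (p (z - 0))"
    unfolding mdiam_def using \<Delta>_le z by (intro SUP_least) (force simp: S_def d intro: order_trans)
  also have "\<dots> \<le> mdiam (UNIV :: 'a set) (\<lambda>x y. p (x - y))"
    unfolding mdiam_def by (intro SUP_upper2[of z] SUP_upper2[of 0]) auto
  finally have "\<exists>e::real \<Rightarrow> 'a. \<forall>x\<in>S. \<forall>y\<in>S. p (e x - e y) = d x y"
    using U metric sep unfolding urysohn_vg_def by blast
  then obtain e where e: "\<And>x y. x \<in> S \<Longrightarrow> y \<in> S \<Longrightarrow> p (e x - e y) = d x y"
    by blast
  define \<theta> where "\<theta> u = e (\<sigma> u)" for u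
  have \<theta>: "p (\<theta> u - \<theta> v) = \<Delta> u v" if "u \<in> Y" "v \<in> Y" for u v
    using e d that by (simp add: \<theta>_def S_def)
  have Some_Y: "Some a \<in> Y" if "a \<in> A" for a
    using that by (simp add: Y_def)
  have inj: "inj_on (\<lambda>a. \<theta> (Some a)) A"
  proof (rule inj_onI)
    fix a b assume ab: "a \<in> A" "b \<in> A" "\<theta> (Some a) = \<theta> (Some b)"
    then show "a = b"
      using \<theta>[OF Some_Y Some_Y, OF ab(1,2)] by (simp add: \<Delta>_def)
  qed
  let ?F = "(\<lambda>a. \<theta> (Some a)) ` A" and ?g = "inv_into A (\<lambda>a. \<theta> (Some a))"
  have g: "?g (\<theta> (Some a)) = a" if "a \<in> A" for a
    using inv_into_f_f[OF inj that] by simp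
  have "\<forall>x\<in>?F. \<forall>y\<in>?F. p (?g x - ?g y) = p (x - y)"
    using \<theta> Some_Y by (auto simp: g \<Delta>_def)
  moreover have "\<forall>F (g::'a \<Rightarrow> 'a). finite F \<and> (\<forall>x\<in>F. \<forall>y\<in>F. p (g x - g y) = p (x - y)) \<longrightarrow>
      (\<exists>h. bij h \<and> (\<forall>x y. p (h x - h y) = p (x - y)) \<and> (\<forall>x\<in>F. h x = g x))"
    using U unfolding urysohn_vg_def by (elim conjE)
  ultimately have "\<exists>h. bij h \<and> (\<forall>x y. p (h x - h y) = p (x - y)) \<and> (\<forall>x\<in>?F. h x = ?g x)"
    using A by (elim allE[of _ ?F] allE[of _ ?g]) (erule mp, simp)
  then obtain h where h: "\<And>x y. p (h x - h y) = p (x - y)" "\<And>x. x \<in> ?F \<Longrightarrow> h x = ?g x"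
    by blast
  have "\<kappa> = p (a - h (\<theta> None))" if a: "a \<in> A" for a
  proof -
    have "h (\<theta> (Some a)) = a"
      using h(2)[of "\<theta> (Some a)"] g[OF a] a by simp
    then have "p (a - h (\<theta> None)) = p (\<theta> (Some a) - \<theta> None)"
      using h(1)[of "\<theta> (Some a)" "\<theta> None"] by simp
    also have "\<dots> = \<kappa>"
      using \<theta>[OF Some_Y[OF a], of None] by (simp add: Y_def \<Delta>_def)
    finally show ?thesis by simp
  qed
  then show ?thesis
    by (auto simp: trivial_in_def)
qed

lemma is_GG_not_urysohn:
  assumes GG: "is_GG r N p" and N: "N > 2" and r: "1 \<le> r"
  shows "\<not> urysohn_vg p"
proof
  assume U: "urysohn_vg p"
  have "N > 1"
    using N by simp
  from is_GG_nontrivial_constant[OF this GG N r] show False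
    using urysohn_vg_constant_trivial[OF is_GG_D(1)[OF GG] U] by blast
qed

theorem theorem5p5:
  fixes r s :: ereal and N M :: nat
    and p :: "'a::ab_group_add \<Rightarrow> real" and q :: "'b::ab_group_add \<Rightarrow> real"
  shows
   "(r \<in> {1, \<infinity>} \<and> N > 2 \<and> is_GG r N p \<longrightarrow>
       k_property r p N \<and> (\<forall>k. k_property r p k \<longrightarrow> N \<le> k))
    \<and> (r \<in> {1, \<infinity>} \<and> s \<in> {1, \<infinity>} \<and> N \<noteq> 1 \<and> M \<noteq> 1 \<and> (r, N) \<noteq> (s, M) \<and>
         is_GG r N p \<and> is_GG s M q \<longrightarrow>
       (isometric_vg p q \<longleftrightarrow> r = s \<and> {N, M} = {0, 2}))
    \<and> (r \<in> {1, \<infinity>} \<and> N > 2 \<and> is_GG r N p \<longrightarrow> \<not> urysohn_vg p)"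
proof -
  have "1 \<le> r" if "r \<in> {1, \<infinity>}"
    using that by auto
  then show ?thesis
    using is_GG_k_property[of r N p] is_GG_k_property_lower[of r N p] is_GG_isometric_iff[of r N p s M q]
      is_GG_not_urysohn[of r N p] by simp
qed

end
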